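(* Let $A\in\mathbb{C}^{m\times n}$ be a matrix of rank $r$, and let its singular value decomposition be $$A=U\Sigma V^*,\qquad \Sigma=\mathrm{diag}(s_1,\dots,s_r,0,\dots,0),$$ with singular values $s_1\ge\cdots\ge s_r>0$. For $1\le i\le r$ define $\Sigma_i=\mathrm{diag}(0,\dots,0,s_i,0,\dots,0)$ (with $s_i$ in the $i$-th diagonal position), so that $A=U\Sigma_1V^*+U\Sigma_2V^*+\cdots+U\Sigma_rV^*$. Then, for $1\le k\le r$, the critical points of the Hermitian distance function from $A$ to the variety of matrices of rank at most $k$ are precisely the matrices of the form $$U(\Sigma_{i_1}+\cdots+\Sigma_{i_k})V^*,\qquad 1\le i_1<\cdots<i_k\le r.$$ In particular, if the nonzero singular values of $A$ are distinct, then for each $k\le r$ there are exactly $\binom{r}{k}$ such critical points.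
   Context: Here $U\in\mathbb{C}^{m\times m}$ and $V\in\mathbb{C}^{n\times n}$ are unitary, $^*$ is conjugate transpose, and $\mathrm{diag}(\cdot)$ denotes an $m\times n$ rectangular diagonal matrix. Let $M_k\subset\mathbb{C}^{m\times n}$ be the variety of matrices of rank at most $k$, viewed as a real algebraic set, and $M_k^{\mathrm{reg}}$ its set of smooth points. A critical point of the Hermitian distance function from $A$ to $M_k$ is a point $X\in M_k^{\mathrm{reg}}$ with $\mathrm{Re}\,\mathrm{Tr}((A-X)B^* )=0$ for all $B\in T_XM_k$.
   Formalization: If nonzero singular values repeat, U and V range over all singular value decompositions of A: for one fixed U, V the claim fails (A = I_2, k = 1: every rank-one orthogonal projection is critical). For distinct nonzero singular values the given U, V are used. *)

theory Defs
  imports "HOL-Analysis.Analysis"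
begin

definition conj_transpose :: "complex^'n^'m \<Rightarrow> complex^'m^'n" where
  "conj_transpose A = map_matrix cnj (transpose A)"

definition unitary_matrix :: "complex^'n^'n \<Rightarrow> bool" where
  "unitary_matrix U \<longleftrightarrow>
     conj_transpose U ** U = mat 1 \<and> U ** conj_transpose U = mat 1"

text \<open>
  Index types of matrices carry no order. Positions in a rectangular diagonal matrix are
  therefore given by numberings \<open>\<rho> : 'm \<rightarrow> {1..CARD('m)}\<close> of the rows and
  \<open>\<kappa> : 'n \<rightarrow> {1..CARD('n)}\<close> of the columns. The entry in row number \<open>i\<close> and column
  number \<open>i\<close> is \<open>d i\<close>; only the values \<open>d i\<close> with \<open>1 \<le> i \<le> min CARD('m) CARD('n)\<close> occur.
\<close>

definition rect_diag ::
    "('m::finite \<Rightarrow> nat) \<Rightarrow> ('n::finite \<Rightarrow> nat) \<Rightarrow> (nat \<Rightarrow> real) \<Rightarrow> complex^'n^'m" where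
  "rect_diag \<rho> \<kappa> d = (\<chi> a b. if \<rho> a = \<kappa> b then complex_of_real (d (\<rho> a)) else 0)"

definition single_diag ::
    "('m::finite \<Rightarrow> nat) \<Rightarrow> ('n::finite \<Rightarrow> nat) \<Rightarrow> (nat \<Rightarrow> real) \<Rightarrow> nat \<Rightarrow> complex^'n^'m" where
  "single_diag \<rho> \<kappa> s i = rect_diag \<rho> \<kappa> (\<lambda>j. if j = i then s i else 0)"

definition is_svd ::
    "('m::finite \<Rightarrow> nat) \<Rightarrow> ('n::finite \<Rightarrow> nat) \<Rightarrow> complex^'n^'m \<Rightarrow> nat \<Rightarrow>
     complex^'m^'m \<Rightarrow> (nat \<Rightarrow> real) \<Rightarrow> complex^'n^'n \<Rightarrow> bool" where
  "is_svd \<rho> \<kappa> A r U s V \<longleftrightarrow>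
     unitary_matrix U \<and> unitary_matrix V \<and>
     (\<forall>i j. 1 \<le> i \<longrightarrow> i \<le> j \<longrightarrow> j \<le> r \<longrightarrow> s j \<le> s i) \<and> (\<forall>i\<in>{1..r}. 0 < s i) \<and>
     A = U ** rect_diag \<rho> \<kappa> (\<lambda>i. if i \<le> r then s i else 0) ** conj_transpose V"

text \<open>
  Real algebraic sets in a Euclidean space. For a matrix space over the complex numbers,
  \<^const>\<open>real_polynomial_function\<close> means a real polynomial in the real and imaginary parts
  of the entries.
\<close>

definition vanishing_ideal :: "'a::euclidean_space set \<Rightarrow> ('a \<Rightarrow> real) set" where
  "vanishing_ideal M = {f. real_polynomial_function f \<and> (\<forall>x\<in>M. f x = 0)}"

definition gradients_at :: "'a::euclidean_space set \<Rightarrow> 'a \<Rightarrow> 'a set" where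
  "gradients_at M x = {g. \<exists>f\<in>vanishing_ideal M. GDERIV f x :> g}"

text \<open>
  For \<open>x \<in> M\<close> the gradients of all members of the ideal form a linear space, spanned by the
  gradients of any generators. Its dimension is the rank at \<open>x\<close> of the Jacobian matrix of
  a generating system.
\<close>

definition jacobian_rank :: "'a::euclidean_space set \<Rightarrow> 'a \<Rightarrow> nat" where
  "jacobian_rank M x = dim (gradients_at M x)"

text \<open>
  The Jacobian criterion in the form of Whitney and Milnor: a point is smooth if the Jacobian
  rank attains its maximum over \<open>M\<close> there. For irreducible \<open>M\<close> the maximum is the codimension.
\<close>

definition smooth_points :: "'a::euclidean_space set \<Rightarrow> 'a set" where
  "smooth_points M = {x \<in> M. \<forall>y\<in>M. jacobian_rank M y \<le> jacobian_rank M x}"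

definition tangent_space :: "'a::euclidean_space set \<Rightarrow> 'a \<Rightarrow> 'a set" where
  "tangent_space M x = {v. \<forall>g\<in>gradients_at M x. inner v g = 0}"

definition rank_variety :: "nat \<Rightarrow> (complex^'n^'m) set" where
  "rank_variety k = {X. rank X \<le> k}"

definition hermitian_critical_points ::
    "complex^'n^'m \<Rightarrow> (complex^'n^'m) set \<Rightarrow> (complex^'n^'m) set" where
  "hermitian_critical_points A M =
     {X \<in> smooth_points M. \<forall>B\<in>tangent_space M X. Re (trace ((A - X) ** conj_transpose B)) = 0}"

end

theory Submission
  imports Defs
begin

text \<open>
Write \<open>X\<^sup>*\<close> for the conjugate transpose. The real inner product of the Euclidean space of
matrices is \<open>Re (Tr (B C\<^sup>*))\<close>, so a smooth point \<open>X\<close> is critical when the residual \<open>A - X\<close> is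
orthogonal to the tangent space. The tangent space is the orthogonal complement of the linear
space of gradients of the ideal; hence a smooth \<open>X\<close> is critical iff \<open>A - X\<close> is itself such a gradient.

The gradients are computed exactly (\<open>gradients_eq_normal_space\<close>, \<open>gradients_lower_rank\<close>). If
\<open>X\<close> has rank \<open>k\<close>, they are the matrices \<open>G\<close> with \<open>X\<^sup>* G = 0\<close> and \<open>G X\<^sup>* = 0\<close>. They satisfy
these equations because the lines \<open>X + t X C\<close> and \<open>X + t C X\<close> stay in the variety. They fill the
space cut out by the equations because bordered determinants supply enough polynomials in the
ideal: for every \<open>u\<close> orthogonal to the columns of \<open>X\<close> and every \<open>v\<close> in its kernel there is one
with derivative \<open>Re (u\<^sup>* B v)\<close> in each normal direction \<open>B\<close>. If \<open>X\<close> has rank below \<open>k\<close>,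
every line \<open>X + t u v\<^sup>*\<close> stays in the variety and all gradients vanish. As the dimension of the
normal space depends only on the rank, all matrices of rank exactly \<open>k\<close> are smooth. A matrix of
smaller rank is never critical, since it would have to equal \<open>A\<close>. So the critical points are the
\<open>X\<close> of rank \<open>k\<close> with \<open>X\<^sup>* (A - X) = 0\<close> and \<open>(A - X) X\<^sup>* = 0\<close>
(\<open>critical_iff_residual_normal\<close>).

It remains to solve these equations. Partial sums of a singular value decomposition satisfy them,
because different \<open>\<Sigma>\<^sub>i\<close> have no common row or column. Conversely let \<open>A = U \<Sigma> V\<^sup>*\<close> and put
\<open>Y = U\<^sup>* X V\<close>. Then \<open>Y\<^sup>* \<Sigma> = Y\<^sup>* Y\<close> and \<open>\<Sigma> Y\<^sup>* = Y Y\<^sup>*\<close> are Hermitian, and this forces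
\<open>Y = \<Sigma> P\<close> for an orthogonal projection \<open>P\<close> that only mixes indices with equal positive singular
values (\<open>polar_factor_is_projection\<close>). Such a \<open>P\<close> is diagonalised by a unitary matrix \<open>Q\<close> which
also respects these blocks, and \<open>\<Sigma> Q = Q' \<Sigma>\<close> for a unitary \<open>Q'\<close>. Then \<open>U Q'\<close> and \<open>V Q\<close> give
another singular value decomposition of \<open>A\<close>, and in it \<open>X\<close> is the partial sum over the indices
where \<open>Q\<^sup>* P Q\<close> has the entry 1. If the singular values are distinct, the blocks have size one,
\<open>P\<close> is already diagonal, and \<open>X\<close> is a partial sum of the given decomposition; the partial sums are
then counted by the \<open>k\<close>-element subsets of \<open>{1..r}\<close>.
\<close>

section \<open>The adjoint and the two inner products\<close>

definition cdot :: "complex^'n \<Rightarrow> complex^'n \<Rightarrow> complex" where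
  "cdot u v = (\<Sum>i\<in>UNIV. cnj (u $ i) * v $ i)"

definition outer :: "complex^'m \<Rightarrow> complex^'n \<Rightarrow> complex^'n^'m" where
  "outer u v = (\<chi> i j. u $ i * cnj (v $ j))"

lemma ct_nth [simp]: "conj_transpose A $ i $ j = cnj (A $ j $ i)"
  by (simp add: conj_transpose_def transpose_def)

lemma ct_ct [simp]: "conj_transpose (conj_transpose A) = A"
  by (simp add: vec_eq_iff)

lemma ct_mult: "conj_transpose (A ** B) = conj_transpose B ** conj_transpose A"
  by (simp add: vec_eq_iff matrix_matrix_mult_def mult.commute)

lemma ct_add: "conj_transpose (A + B) = conj_transpose A + conj_transpose B"
  by (simp add: vec_eq_iff)

lemma ct_diff: "conj_transpose (A - B) = conj_transpose A - conj_transpose B"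
  by (simp add: vec_eq_iff)

lemma ct_0 [simp]: "conj_transpose 0 = 0"
  by (simp add: vec_eq_iff)

lemma ct_eq_0_iff [simp]: "conj_transpose A = 0 \<longleftrightarrow> A = 0"
  by (metis ct_0 ct_ct)

lemma ct_mat_1 [simp]: "conj_transpose (mat 1) = mat 1"
  by (auto simp: vec_eq_iff mat_def)

lemma ct_outer [simp]: "conj_transpose (outer u v) = outer v u"
  by (simp add: vec_eq_iff outer_def mult.commute)

lemma matrix_add_rdistrib: "(A + B) ** C = A ** C + B ** C"
  and matrix_diff_ldistrib: "C' ** (A' - B') = C' ** A' - C' ** B'"
  and matrix_diff_rdistrib: "(A - B) ** C = A ** C - B ** C"
  for A B :: "'a::comm_ring_1^'n^'m" and C' :: "'a^'n^'m"
  by (simp_all add: vec_eq_iff matrix_matrix_mult_def algebra_simps sum.distrib sum_subtractf)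

lemmas matrix_distribs =
  matrix_add_ldistrib matrix_add_rdistrib matrix_diff_ldistrib matrix_diff_rdistrib

lemma mult_outer: "A ** outer u v = outer (A *v u) v"
  by (simp add: vec_eq_iff outer_def matrix_matrix_mult_def matrix_vector_mult_def sum_distrib_right mult.assoc)

lemma outer_mult: "outer u v ** A = outer u (conj_transpose A *v v)"
  by (simp add: vec_eq_iff outer_def matrix_matrix_mult_def matrix_vector_mult_def sum_distrib_left
      mult.assoc mult.commute mult.left_commute)

lemma outer_0_left [simp]: "outer 0 v = 0"
  and outer_0_right [simp]: "outer u 0 = 0"
  by (simp_all add: vec_eq_iff outer_def)

lemma outer_diff_left: "outer (u - u') v = outer u v - outer u' v"
  and outer_scaleR_left: "outer (t *\<^sub>R u) v = t *\<^sub>R outer u v"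
  by (simp_all add: vec_eq_iff outer_def algebra_simps)

lemma outer_mult_vec: "outer u v *v x = cdot v x *s u"
  by (simp add: vec_eq_iff outer_def cdot_def matrix_vector_mult_def sum_distrib_left mult_ac)

lemma cdot_adjoint: "cdot u (A *v v) = cdot (conj_transpose A *v u) v"
  unfolding cdot_def matrix_vector_mult_def
  by (simp add: sum_distrib_left sum_distrib_right) (subst sum.swap, simp add: mult_ac)

lemma cdot_diff_right: "cdot u (v - w) = cdot u v - cdot u w"
  and cdot_add_right: "cdot u (v + w) = cdot u v + cdot u w"
  and cdot_scale_right: "cdot u (c *s v) = c * cdot u v"
  and cdot_scaleR_right: "cdot u (t *\<^sub>R v) = of_real t * cdot u v"
  and cdot_scaleR_left: "cdot (t *\<^sub>R u) v = of_real t * cdot u v"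
  by (simp_all add: cdot_def sum_subtractf sum.distrib sum_distrib_left algebra_simps
      scaleR_conv_of_real[where 'a=complex])

lemma cdot_0 [simp]: "cdot 0 v = 0" "cdot v 0 = 0"
  by (simp_all add: cdot_def)

lemma cdot_commute: "cdot v u = cnj (cdot u v)"
  by (simp add: cdot_def mult.commute)

lemma cdot_self: "cdot u u = of_real ((norm u)\<^sup>2)"
proof -
  have "(norm u)\<^sup>2 = (\<Sum>i\<in>UNIV. (norm (u $ i))\<^sup>2)"
    by (simp add: norm_vec_def L2_set_def sum_nonneg)
  then show ?thesis
    by (simp add: cdot_def complex_norm_square[symmetric] mult.commute)
qed

lemma cdot_self_eq_0 [simp]: "cdot u u = 0 \<longleftrightarrow> u = 0"
  by (simp add: cdot_self)

lemma inner_matrix: "inner A B = Re (trace (A ** conj_transpose B))"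
  by (simp add: trace_def inner_vec_def matrix_matrix_mult_def inner_complex_def)

lemma inner_outer: "inner B (outer u v) = Re (cdot u (B *v v))"
  by (simp add: inner_vec_def inner_complex_def cdot_def outer_def matrix_vector_mult_def sum_distrib_left algebra_simps)

lemma inner_mult_left: "inner (A ** B) C = inner B (conj_transpose A ** C)"
proof -
  have "inner (A ** B) C = Re (trace (A ** (B ** conj_transpose C)))"
    by (simp add: inner_matrix matrix_mul_assoc)
  also have "\<dots> = Re (trace ((B ** conj_transpose C) ** A))"
    by (subst trace_mul_sym) simp
  also have "\<dots> = inner B (conj_transpose A ** C)"
    by (simp add: inner_matrix ct_mult matrix_mul_assoc)
  finally show ?thesis .
qed

lemma inner_mult_right: "inner (A ** B) C = inner A (C ** conj_transpose B)"
  by (simp add: inner_matrix ct_mult matrix_mul_assoc)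

lemma ct_mult_self_eq_0: "conj_transpose A ** A = 0 \<longleftrightarrow> A = 0"
  and mult_ct_self_eq_0: "A ** conj_transpose A = 0 \<longleftrightarrow> A = 0"
proof -
  have "inner A A = 0" if "conj_transpose A ** A = 0"
    using inner_mult_left[of A "mat 1" A] that by simp
  moreover have "inner A A = 0" if "A ** conj_transpose A = 0"
    using that by (simp add: inner_matrix trace_def)
  ultimately show "conj_transpose A ** A = 0 \<longleftrightarrow> A = 0"  "A ** conj_transpose A = 0 \<longleftrightarrow> A = 0"
    by auto
qed

section \<open>Rank of complex matrices\<close>

text \<open>
Sums of \<open>k\<close> rank-one matrices behave in the same way under adjoints, products on either side and
addition. So the behaviour of the rank under these operations, and the equality of row and column
rank, can be read off from this form.
\<close>

lemma rank_le_iff_sum_outer: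
  fixes X :: "complex^'n^'m"
  shows "rank X \<le> k \<longleftrightarrow> (\<exists>c b. X = (\<Sum>l<k. outer (c l) (b l)))"
proof
  assume le: "rank X \<le> k"
  obtain B where B: "B \<subseteq> rows X" "vec.independent B" "rows X \<subseteq> vec.span B" "card B = rank X"
    using vec.basis_exists[of "rows X"] unfolding row_rank_def_gen by blast
  have finB: "finite B"
    using B(1) by (rule finite_subset) (simp add: rows_def full_SetCompr_eq)
  obtain h where h: "bij_betw h {..<card B} B"
    using finB ex_bij_betw_nat_finite[of B] by (auto simp: atLeast0LessThan)
  have "\<exists>a. \<forall>i. row i X = (\<Sum>v\<in>B. a i v *s v)"
  proof -
    have "\<forall>i. \<exists>a. row i X = (\<Sum>v\<in>B. a v *s v)"
      using B(3) vec.span_finite[OF finB] by (auto simp: rows_def)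
    then show ?thesis by metis
  qed
  then obtain a where a: "row i X = (\<Sum>v\<in>B. a i v *s v)" for i
    by blast
  \<comment> \<open>Zero vectors pad the sum when the rank is smaller than \<open>k\<close>.\<close>
  define b where "b l = (if l < card B then (\<chi> j. cnj (h l $ j)) else 0)" for l
  define c where "c l = (\<chi> i. a i (h l))" for l
  have "X $ i $ j = (\<Sum>l<k. outer (c l) (b l)) $ i $ j" for i j
  proof -
    have "X $ i $ j = row i X $ j"
      by (simp add: row_def)
    also have "\<dots> = (\<Sum>v\<in>B. a i v * v $ j)"
      by (simp add: a)
    also have "\<dots> = (\<Sum>l<card B. a i (h l) * h l $ j)"
      by (rule sum.reindex_bij_betw[OF h, symmetric])
    also have "\<dots> = (\<Sum>l<k. if l < card B then a i (h l) * h l $ j else 0)"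
      using le B(4) by (intro sum.mono_neutral_cong_left) auto
    also have "\<dots> = (\<Sum>l<k. outer (c l) (b l)) $ i $ j"
      by (auto simp: outer_def b_def c_def intro!: sum.cong)
    finally show ?thesis .
  qed
  then show "\<exists>c b. X = (\<Sum>l<k. outer (c l) (b l))"
    by (auto simp: vec_eq_iff)
next
  assume "\<exists>c b. X = (\<Sum>l<k. outer (c l) (b l))"
  then obtain c b where X: "X = (\<Sum>l<k. outer (c l) (b l))"
    by blast
  define g where "g l = (\<chi> j. cnj (b l $ j))" for l
  have "row i X = (\<Sum>l<k. c l $ i *s g l)" for i
    by (simp add: vec_eq_iff X row_def g_def outer_def)
  then have "rows X \<subseteq> vec.span (g ` {..<k})"
    by (auto simp: rows_def intro!: vec.span_sum vec.span_scale intro: vec.span_base)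
  then have "vec.dim (rows X) \<le> card (g ` {..<k})"
    by (intro vec.dim_le_card) auto
  also have "\<dots> \<le> k"
    using card_image_le[of "{..<k}" g] by simp
  finally show "rank X \<le> k"
    by (simp add: row_rank_def_gen)
qed

lemma sum_outer_rank:
  obtains c b where "(X :: complex^'n^'m) = (\<Sum>l<rank X. outer (c l) (b l))"
  using rank_le_iff_sum_outer[of X "rank X"] by auto

lemma matrix_sum_ldistrib: "A ** sum f S = (\<Sum>x\<in>S. A ** f x)"
  for A :: "'a::comm_semiring_1^'n^'m" and f :: "'b \<Rightarrow> 'a^'k^'n"
  by (induction S rule: infinite_finite_induct)
    (simp_all add: matrix_add_ldistrib matrix_matrix_mult_def vec_eq_iff sum.distrib ring_distribs)

lemma matrix_sum_rdistrib: "sum f S ** A = (\<Sum>x\<in>S. f x ** A)"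
  for A :: "'a::comm_semiring_1^'n^'m" and f :: "'b \<Rightarrow> 'a^'m^'k"
  by (induction S rule: infinite_finite_induct)
    (simp_all add: matrix_add_rdistrib matrix_matrix_mult_def vec_eq_iff sum.distrib ring_distribs)

lemma ct_sum: "conj_transpose (sum f S) = (\<Sum>x\<in>S. conj_transpose (f x))"
  by (induction S rule: infinite_finite_induct) (simp_all add: ct_add)

lemma rank_mult_le_right: "rank (A ** B) \<le> rank B" for B :: "complex^'n^'m"
proof -
  obtain c b where "B = (\<Sum>l<rank B. outer (c l) (b l))"
    by (rule sum_outer_rank)
  then have "A ** B = A ** (\<Sum>l<rank B. outer (c l) (b l))"
    by (rule arg_cong)
  then have "A ** B = (\<Sum>l<rank B. outer (A *v c l) (b l))"
    by (simp add: matrix_sum_ldistrib mult_outer)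
  then show ?thesis
    unfolding rank_le_iff_sum_outer by (intro exI)
qed

lemma rank_ct_le: "rank (conj_transpose X) \<le> rank X"
proof -
  obtain c b where "X = (\<Sum>l<rank X. outer (c l) (b l))"
    by (rule sum_outer_rank)
  then have "conj_transpose X = conj_transpose (\<Sum>l<rank X. outer (c l) (b l))"
    by (rule arg_cong)
  then have "conj_transpose X = (\<Sum>l<rank X. outer (b l) (c l))"
    by (simp add: ct_sum)
  then show ?thesis
    unfolding rank_le_iff_sum_outer by (intro exI)
qed

lemma rank_ct [simp]: "rank (conj_transpose X) = rank X"
  using rank_ct_le[of X] rank_ct_le[of "conj_transpose X"] by simp

lemma rank_mult_le_left: "rank (A ** B) \<le> rank A" for A :: "complex^'n^'m"
  by (metis ct_mult rank_ct rank_mult_le_right)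

lemma sum_lessThan_add:
  fixes f :: "nat \<Rightarrow> 'a::comm_monoid_add"
  shows "sum f {..<k + l} = sum f {..<k} + (\<Sum>i<l. f (k + i))"
  by (induction l) (simp_all add: add.assoc)

lemma rank_add_le: "rank (X + Y) \<le> rank X + rank Y" for X :: "complex^'n^'m"
proof -
  obtain c b where X: "X = (\<Sum>l<rank X. outer (c l) (b l))"
    by (rule sum_outer_rank)
  obtain c' b' where Y: "Y = (\<Sum>l<rank Y. outer (c' l) (b' l))"
    by (rule sum_outer_rank)
  define k where "k = rank X"
  define c'' where "c'' l = (if l < k then c l else c' (l - k))" for l
  define b'' where "b'' l = (if l < k then b l else b' (l - k))" for l
  have "X + Y = (\<Sum>l<k + rank Y. outer (c'' l) (b'' l))"
    unfolding sum_lessThan_add using X Y by (simp add: c''_def b''_def k_def)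
  then show ?thesis
    unfolding k_def[symmetric] rank_le_iff_sum_outer by blast
qed

lemma rank_outer_le: "rank (outer u v) \<le> 1"
  unfolding rank_le_iff_sum_outer by (intro exI[of _ "\<lambda>_. u"] exI[of _ "\<lambda>_. v"]) simp

lemma matrix_vector_mult_scaleR_complex: "A *v (t *\<^sub>R x) = t *\<^sub>R (A *v x)"
  for A :: "complex^'n^'m"
  by (simp add: vec_eq_iff matrix_vector_mult_def scaleR_sum_right)

lemma sum_matrix_vector: "sum f S *v x = (\<Sum>l\<in>S. f l *v x)" for f :: "'b \<Rightarrow> 'a::comm_ring_1^'n^'m"
  by (induction S rule: infinite_finite_induct) (simp_all add: matrix_vector_mult_add_rdistrib)

lemma rank_le_CARD: "rank (X :: complex^'n^'m) \<le> CARD('n)" "rank (X :: complex^'n^'m) \<le> CARD('m)"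
  using dim_subset_UNIV_cart_gen[of "rows X"]  dim_subset_UNIV_cart_gen[of "rows (conj_transpose X)"]
  unfolding row_rank_def_gen[symmetric] by auto

lemma dim_range_le_rank: "vec.dim (range ((*v) X)) \<le> rank X" for X :: "complex^'n^'m"
proof -
  obtain c b where X: "X = (\<Sum>l<rank X. outer (c l) (b l))"
    by (rule sum_outer_rank)
  have "X *v x \<in> vec.span (c ` {..<rank X})" for x
    by (subst X, unfold sum_matrix_vector outer_mult_vec)
      (auto intro!: vec.span_sum vec.span_scale intro: vec.span_base)
  then have "vec.dim (range ((*v) X)) \<le> card (c ` {..<rank X})"
    by (intro vec.dim_le_card) auto
  also have "\<dots> \<le> rank X"
    using card_image_le[of "{..<rank X}" c] by simp
  finally show ?thesis .
qed

lemma dim_range: "vec.dim (range ((*v) X)) = rank X" for X :: "complex^'n^'m"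
proof (rule antisym[OF dim_range_le_rank])
  have "columns X \<subseteq> range ((*v) X)"
  proof
    fix x assume "x \<in> columns X"
    then obtain j where "x = column j X"
      by (auto simp: columns_def)
    then have "x = X *v axis j 1"
      by (simp add: vec_eq_iff column_def matrix_vector_mult_def axis_def if_distrib cong: if_cong)
    then show "x \<in> range ((*v) X)"
      by blast
  qed
  moreover have "rank X \<le> rank (transpose X)"
  proof -
    obtain c b where "transpose X = (\<Sum>l<rank (transpose X). outer (c l) (b l))"
      by (rule sum_outer_rank)
    then have "X = transpose (\<Sum>l<rank (transpose X). outer (c l) (b l))"
      by (metis transpose_transpose)
    also have "\<dots> = (\<Sum>l<rank (transpose X). outer (\<chi> i. cnj (b l $ i)) (\<chi> i. cnj (c l $ i)))"
      by (simp add: vec_eq_iff transpose_def outer_def mult.commute)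
    finally show ?thesis
      unfolding rank_le_iff_sum_outer by (intro exI)
  qed
  ultimately show "rank X \<le> vec.dim (range ((*v) X))"
    using vec.dim_subset[of "columns X" "range ((*v) X)"]
    by (simp add: row_rank_def_gen rows_transpose)
qed

text \<open>
The complement \<open>mat 1 - \<pi>\<close> of any linear projection \<open>\<pi>\<close> onto \<open>S\<close>.
\<close>

lemma exists_matrix_with_kernel:
  fixes S :: "(complex^'n) set"
  assumes "vec.subspace S"
  obtains C :: "complex^'n^'n" where "\<And>z. C *v z = 0 \<longleftrightarrow> z \<in> S" "\<And>z. z - C *v z \<in> S"
proof -
  have "Vector_Spaces.linear (*s) (*s) (\<lambda>x::complex^'n. x)"
    by (simp add: vec.linear_ident)
  then obtain g where g: "range g \<subseteq> S" "Vector_Spaces.linear (*s) (*s) g" "\<forall>v\<in>S. g v = v"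
    using vec.linear_exists_left_inverse_on[of "\<lambda>x. x" S] assms by auto
  define C where "C = mat 1 - matrix g"
  have C: "C *v z = z - g z" for z
    using g(2) by (simp add: C_def matrix_vector_mult_diff_rdistrib matrix_works)
  then have "C *v z = 0 \<longleftrightarrow> z \<in> S" for z
    using g(1,3) by (metis eq_iff_diff_eq_0 range_subsetD)
  moreover have "z - C *v z \<in> S" for z
    using g(1) by (auto simp: C)
  ultimately show ?thesis
    by (rule that)
qed

lemma subspace_kernel: "vec.subspace {z. X *v z = 0}" for X :: "'a::field^'n^'m"
  by (rule vec.linear_subspace_kernel) simp

text \<open>
Rank-nullity: \<open>X\<close> is injective on the range of a projection along its kernel, and that range is
a complement of the kernel.
\<close>

lemma dim_kernel: "vec.dim {z. X *v z = 0} + rank X = CARD('n)" for X :: "complex^'n^'m"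
proof -
  let ?K = "{z. X *v z = 0}"
  have K: "vec.subspace ?K"
    by (rule subspace_kernel)
  obtain C :: "complex^'n^'n" where C: "\<And>z. C *v z = 0 \<longleftrightarrow> z \<in> ?K" "\<And>z. z - C *v z \<in> ?K"
    using exists_matrix_with_kernel[OF K] by blast
  have XC: "X *v (C *v z) = X *v z" for z
    using C(2)[of z] by (simp add: matrix_vector_mult_diff_distrib)
  let ?R = "range ((*v) C)"
  have R: "vec.subspace ?R"
    using vec.linear_subspace_image[of "(*v) C" UNIV] by simp
  have zero: "y = 0" if y: "y \<in> ?R" "X *v y = 0" for y
  proof -
    obtain z where z: "y = C *v z" using y(1) by blast
    then have "X *v z = 0" using y(2) XC by simp
    then show ?thesis using C(1)[of z] by (simp add: z)
  qed
  have "vec.dim ?R = vec.dim ((*v) X ` ?R)"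
  proof (rule vec.dim_image_eq[symmetric])
    have "inj_on ((*v) X) ?R"
      using zero R by (intro inj_onI)
        (metis eq_iff_diff_eq_0 matrix_vector_mult_diff_distrib vec.subspace_diff)
    then show "inj_on ((*v) X) (vec.span ?R)"
      using R by (simp add: vec.span_eq_iff[THEN iffD2])
  qed auto
  also have "(*v) X ` ?R = range ((*v) X)"
    by (auto simp: image_image XC)
  finally have "vec.dim ?R = rank X"
    by (simp add: dim_range)
  moreover have "{x + y |x y. x \<in> ?K \<and> y \<in> ?R} = UNIV"
  proof -
    have "\<exists>x y. z = x + y \<and> X *v x = 0 \<and> y \<in> ?R" for z
      using C(2)[of z] by (intro exI[of _ "z - C *v z"] exI[of _ "C *v z"]) auto
    then show ?thesis by auto
  qed
  moreover have "?K \<inter> ?R = {0}"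
    using zero K R by (auto simp: vec.subspace_0)
  ultimately show ?thesis
    using vec.dim_sums_Int[OF K R] by (simp add: card_cart_basis)
qed

section \<open>The determinant of a rank-one perturbation\<close>

lemma det_mat_1_replace_column:
  "det ((\<chi> i j. if j = p then x $ i else mat 1 $ i $ j) :: 'a::field^'n^'n) = x $ p"
  using cramer_lemma[where A = "mat 1 :: 'a^'n^'n" and x = x and k = p] by (simp cong: if_cong)

lemma det_mat_1_replace_row:
  "det ((\<chi> i j. if i = p then x $ j else mat 1 $ i $ j) :: 'a::field^'n^'n) = x $ p"
proof -
  have "det ((\<chi> i j. if i = p then x $ j else mat 1 $ i $ j) :: 'a::field^'n^'n)
     = det (transpose ((\<chi> i j. if j = p then x $ i else mat 1 $ i $ j) :: 'a::field^'n^'n))"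
    by (rule arg_cong[of _ _ det]) (auto simp: vec_eq_iff transpose_def mat_def)
  then show ?thesis
    by (simp add: det_mat_1_replace_column)
qed

text \<open>
Choose \<open>p\<close> with \<open>y\<^sub>p \<noteq> 0\<close> and let \<open>T\<close> be the identity with row \<open>p\<close> replaced by \<open>y\<^sup>*\<close>.
Conjugation by \<open>T\<close> turns \<open>1 + x y\<^sup>*\<close> into a matrix that differs from the identity in column \<open>p\<close>
only, and Cramer's rule gives its determinant.
\<close>

lemma det_mat_1_plus_outer: "det (mat 1 + outer x y) = 1 + cdot y x"
proof (cases "y = 0")
  case False
  then obtain p where p: "y $ p \<noteq> 0"
    by (auto simp: vec_eq_iff)
  define T where "T = (\<chi> i j. if i = p then cnj (y $ j) else mat 1 $ i $ j)"
  define M where "M = (\<chi> i j. if j = p then (axis p 1 + T *v x) $ i else mat 1 $ i $ j)"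
  have detT: "det T = cnj (y $ p)"
    using det_mat_1_replace_row[of p "\<chi> j. cnj (y $ j)"] by (simp add: T_def cong: if_cong)
  have "T ** (mat 1 + outer x y) = M ** T"
  proof -
    have "M = mat 1 + outer (T *v x) (axis p 1)"
      by (auto simp: M_def vec_eq_iff mat_def outer_def axis_def)
    moreover have "conj_transpose T *v axis p 1 = y"
      by (simp add: vec_eq_iff matrix_vector_mult_def axis_def T_def if_distrib cong: if_cong)
    ultimately show ?thesis
      by (simp add: matrix_add_ldistrib matrix_add_rdistrib mult_outer outer_mult)
  qed
  then have "det T * det (mat 1 + outer x y) = det M * det T"
    by (metis det_mul)
  then have "det (mat 1 + outer x y) = det M"
    using p detT by simp
  also have "\<dots> = 1 + (T *v x) $ p"
    unfolding M_def by (subst det_mat_1_replace_column) (simp add: axis_def)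
  also have "(T *v x) $ p = cdot y x"
    by (simp add: matrix_vector_mult_def T_def cdot_def)
  finally show ?thesis .
qed simp

section \<open>Gradients of the ideal of the rank variety\<close>

text \<open>
The complex description of the normal space of the rank variety at \<open>X\<close>: the columns of \<open>G\<close> are
orthogonal to those of \<open>X\<close>, and the rows of \<open>G\<close> to those of \<open>X\<close>.
\<close>

definition normal_space :: "complex^'n^'m \<Rightarrow> (complex^'n^'m) set" where
  "normal_space X = {G. conj_transpose X ** G = 0 \<and> G ** conj_transpose X = 0}"

lemma GDERIV_on_line:
  assumes g: "GDERIV f x :> g" and line: "\<And>t. f (x + t *\<^sub>R b) = t * a"
  shows "inner b g = a"
proof -
  have "((\<lambda>t. x + t *\<^sub>R b) has_derivative (\<lambda>t. t *\<^sub>R b)) (at 0)"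
    by (auto intro!: derivative_eq_intros)
  moreover have "(f has_derivative (\<lambda>h. inner h g)) (at (x + 0 *\<^sub>R b))"
    using g by (simp add: gderiv_def)
  ultimately have "((\<lambda>t. f (x + t *\<^sub>R b)) has_derivative (\<lambda>t. inner (t *\<^sub>R b) g)) (at 0)"
    by (rule has_derivative_compose)
  then have "((\<lambda>t. t * a) has_derivative (\<lambda>t. t * inner b g)) (at 0)"
    by (simp add: line)
  moreover have "((\<lambda>t. t * a) has_derivative (\<lambda>t. t * a)) (at (0::real))"
    by (auto intro!: derivative_eq_intros)
  ultimately have "(\<lambda>t. t * inner b g) = (\<lambda>t. t * a)"
    by (rule has_derivative_unique)
  then show ?thesis
    by (metis mult_1)
qed

lemma real_polynomial_function_GDERIV:
  fixes f :: "'a::euclidean_space \<Rightarrow> real"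
  assumes "real_polynomial_function f"
  obtains g where "GDERIV f x :> g"
proof -
  obtain f' where f': "(f has_derivative f') (at x)"
    using differentiable_at_real_polynomial_function[OF assms] unfolding differentiable_def by blast
  then have "linear f'"
    by (rule has_derivative_linear)
  then have "f' h = inner h (\<Sum>b\<in>Basis. f' b *\<^sub>R b)" for h
    by (subst euclidean_representation[of h, symmetric])
      (simp add: linear_sum linear_scale inner_sum_left inner_sum_right mult.commute
        inner_Basis if_distrib cong: if_cong)
  then have "f' = (\<lambda>h. inner h (\<Sum>b\<in>Basis. f' b *\<^sub>R b))"
    by blast
  then show ?thesis
    using f' that by (metis gderiv_def)
qed

lemma subspace_gradients_at: "subspace (gradients_at M x)"
proof (rule subspaceI)
  have "(\<lambda>_. 0) \<in> vanishing_ideal M"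
    by (auto simp: vanishing_ideal_def)
  then show "0 \<in> gradients_at M x"
    using GDERIV_const by (auto simp: gradients_at_def)
next
  fix g h assume "g \<in> gradients_at M x" "h \<in> gradients_at M x"
  then obtain p q where "p \<in> vanishing_ideal M" "GDERIV p x :> g" "q \<in> vanishing_ideal M" "GDERIV q x :> h"
    by (auto simp: gradients_at_def)
  then have "(\<lambda>x. p x + q x) \<in> vanishing_ideal M" "GDERIV (\<lambda>x. p x + q x) x :> g + h"
    by (auto simp: vanishing_ideal_def intro: GDERIV_add)
  then show "g + h \<in> gradients_at M x"
    by (auto simp: gradients_at_def)
next
  fix c :: real and g assume "g \<in> gradients_at M x"
  then obtain p where "p \<in> vanishing_ideal M" "GDERIV p x :> g"
    by (auto simp: gradients_at_def)
  then have "(\<lambda>x. c * p x) \<in> vanishing_ideal M" "GDERIV (\<lambda>x. c * p x) x :> c *\<^sub>R g"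
    using GDERIV_mult[OF GDERIV_const[of c x], of p g] by (auto simp: vanishing_ideal_def)
  then show "c *\<^sub>R g \<in> gradients_at M x"
    by (auto simp: gradients_at_def)
qed

lemma gradient_orthogonal_line:
  assumes "g \<in> gradients_at M x" and "\<And>t. x + t *\<^sub>R b \<in> M"
  shows "inner b g = 0"
proof -
  obtain f where "f \<in> vanishing_ideal M" "GDERIV f x :> g"
    using assms(1) by (auto simp: gradients_at_def)
  then show ?thesis
    using assms(2) by (intro GDERIV_on_line[of f x]) (auto simp: vanishing_ideal_def)
qed

text \<open>
Right and left multiples of \<open>X\<close> are tangent directions, because \<open>X (1 + t C)\<close> and \<open>(1 + t D) X\<close>
have rank at most \<open>k\<close> for every real \<open>t\<close>.
\<close>

lemma gradients_orthogonal_mult: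
  fixes X :: "complex^'n^'m"
  assumes X: "rank X \<le> k" and g: "g \<in> gradients_at (rank_variety k) X"
  shows "inner (X ** C) g = 0" and "inner (D ** X) g = 0"
proof -
  have "X + t *\<^sub>R (X ** C) = X ** (mat 1 + t *\<^sub>R C)" for t
    by (simp add: matrix_distribs matrix_scalar_ac scalar_matrix_assoc)
  then have "X + t *\<^sub>R (X ** C) \<in> rank_variety k" for t
    using X rank_mult_le_left[of X "mat 1 + t *\<^sub>R C"] by (simp add: rank_variety_def)
  then show "inner (X ** C) g = 0"
    by (rule gradient_orthogonal_line[OF g])
  have "X + t *\<^sub>R (D ** X) = (mat 1 + t *\<^sub>R D) ** X" for t
    by (simp add: matrix_distribs scalar_matrix_assoc)
  then have "X + t *\<^sub>R (D ** X) \<in> rank_variety k" for t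
    using X rank_mult_le_right[of "mat 1 + t *\<^sub>R D" X] by (simp add: rank_variety_def)
  then show "inner (D ** X) g = 0"
    by (rule gradient_orthogonal_line[OF g])
qed

lemma normal_spaceI:
  assumes "\<And>C. inner (X ** C) G = 0" and "\<And>C. inner (C ** X) G = 0"
  shows "G \<in> normal_space X"
  using assms(1)[of "conj_transpose X ** G"] assms(2)[of "G ** conj_transpose X"]
    inner_mult_left[of X "conj_transpose X ** G" G] inner_mult_right[of "G ** conj_transpose X" X G]
  by (simp add: normal_space_def)

lemma gradients_subset_normal_space:
  "rank X \<le> k \<Longrightarrow> gradients_at (rank_variety k) X \<subseteq> normal_space X"
  using gradients_orthogonal_mult by (blast intro: normal_spaceI)

text \<open>
There is room for a further rank-one summand, so the gradient is orthogonal to all matrices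
\<open>u v\<^sup>*\<close>; taking \<open>u = g v\<close> gives \<open>g v = 0\<close>.
\<close>

lemma gradients_lower_rank:
  fixes X :: "complex^'n^'m"
  assumes "rank X < k"
  shows "gradients_at (rank_variety k) X = {0}"
proof -
  have "g = 0" if g: "g \<in> gradients_at (rank_variety k) X" for g
  proof -
    have "g *v v = 0 *v v" for v
    proof -
      have "rank (X + t *\<^sub>R outer (g *v v) v) \<le> k" for t
        using assms rank_add_le[of X "outer (t *\<^sub>R (g *v v)) v"] rank_outer_le[of "t *\<^sub>R (g *v v)" v]
        by (simp add: outer_scaleR_left)
      then have "inner (outer (g *v v) v) g = 0"
        by (intro gradient_orthogonal_line[OF g]) (simp add: rank_variety_def)
      then have "Re (cdot (g *v v) (g *v v)) = 0"
        by (simp add: inner_commute inner_outer)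
      then show ?thesis
        by (simp add: cdot_self)
    qed
    then show ?thesis
      by (simp add: matrix_eq)
  qed
  then show ?thesis
    using subspace_gradients_at[of "rank_variety k" X] subspace_0 by blast
qed

text \<open>
The determinants used below have complex values; this class is closed under the operations that
build them up, and real parts of its members are candidates for the ideal.
\<close>

definition complex_polynomial_function :: "('a::real_normed_vector \<Rightarrow> complex) \<Rightarrow> bool" where
  "complex_polynomial_function f \<longleftrightarrow>
     real_polynomial_function (\<lambda>x. Re (f x)) \<and> real_polynomial_function (\<lambda>x. Im (f x))"

lemma complex_polynomial_function_const: "complex_polynomial_function (\<lambda>x. c)"
  by (auto simp: complex_polynomial_function_def)

lemma complex_polynomial_function_add:
  "complex_polynomial_function f \<Longrightarrow> complex_polynomial_function g \<Longrightarrow>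
   complex_polynomial_function (\<lambda>x. f x + g x)"
  by (auto simp: complex_polynomial_function_def)

lemma complex_polynomial_function_mult:
  "complex_polynomial_function f \<Longrightarrow> complex_polynomial_function g \<Longrightarrow>
   complex_polynomial_function (\<lambda>x. f x * g x)"
  by (auto simp: complex_polynomial_function_def)

lemma complex_polynomial_function_sum:
  "(\<And>i. i \<in> I \<Longrightarrow> complex_polynomial_function (\<lambda>x. f x i)) \<Longrightarrow>
   complex_polynomial_function (\<lambda>x. sum (f x) I)"
  by (induction I rule: infinite_finite_induct)
    (auto intro: complex_polynomial_function_const complex_polynomial_function_add)

lemma complex_polynomial_function_prod:
  "(\<And>i. i \<in> I \<Longrightarrow> complex_polynomial_function (\<lambda>x. f x i)) \<Longrightarrow>
   complex_polynomial_function (\<lambda>x. prod (f x) I)"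
  by (induction I rule: infinite_finite_induct)
    (auto intro: complex_polynomial_function_const complex_polynomial_function_mult)

lemma complex_polynomial_function_entry:
  "complex_polynomial_function (\<lambda>Y::complex^'n^'m. Y $ i $ j)"
  unfolding complex_polynomial_function_def
  by (intro conjI real_polynomial_function.intros(1) linear_conv_bounded_linear[THEN iffD1] linearI) auto

lemma complex_polynomial_function_det:
  fixes F :: "'a::real_normed_vector \<Rightarrow> complex^'n^'n"
  assumes "\<And>i j. complex_polynomial_function (\<lambda>x. F x $ i $ j)"
  shows "complex_polynomial_function (\<lambda>x. det (F x))"
  unfolding det_def
  by (intro complex_polynomial_function_sum complex_polynomial_function_mult
      complex_polynomial_function_prod complex_polynomial_function_const assms)

lemma complex_polynomial_function_affine_entry:
  "complex_polynomial_function (\<lambda>Y::complex^'n^'m. (Y ** R + E) $ i $ j)"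
  by (simp add: matrix_matrix_mult_def)
    (intro complex_polynomial_function_add complex_polynomial_function_sum complex_polynomial_function_mult
      complex_polynomial_function_const complex_polynomial_function_entry)

lemma det_eq_0_if_kernel:
  fixes A :: "'a::field^'n^'n"
  assumes "A *v z = 0" "z \<noteq> 0"
  shows "det A = 0"
  using assms invertible_det_nz[of A] matrix_left_invertible_ker[of A] invertible_left_inverse[of A]
  by blast

lemma kernel_if_det_eq_0:
  fixes A :: "'a::field^'n^'n"
  assumes "det A = 0"
  obtains z where "z \<noteq> 0" "A *v z = 0"
  using assms invertible_det_nz[of A] matrix_left_invertible_ker[of A] invertible_left_inverse[of A]
  by blast

text \<open>
On \<open>S\<close> only \<open>Y ** R\<close> acts, and its rank is too small to be injective there.
\<close>

lemma det_eq_0_if_low_rank: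
  fixes Y :: "complex^'n^'m"
  assumes S: "vec.subspace S" "rank Y < vec.dim S" and E: "\<And>z. z \<in> S \<Longrightarrow> E *v z = 0"
  shows "det (Y ** R + E) = 0"
proof -
  have "\<not> inj_on ((*v) (Y ** R)) S"
  proof
    assume "inj_on ((*v) (Y ** R)) S"
    then have "vec.dim S = vec.dim ((*v) (Y ** R) ` S)"
      using S(1) by (intro vec.dim_image_eq[symmetric]) (auto simp: vec.span_eq_iff[THEN iffD2])
    also have "\<dots> \<le> vec.dim (range ((*v) (Y ** R)))"
      by (rule vec.dim_subset) auto
    also have "\<dots> \<le> rank Y"
      using rank_mult_le_left[of Y R] by (simp add: dim_range)
    finally show False
      using S(2) by simp
  qed
  then obtain z1 z2 where z: "z1 \<in> S" "z2 \<in> S" "z1 \<noteq> z2" "(Y ** R) *v z1 = (Y ** R) *v z2"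
    by (auto simp: inj_on_def)
  have "(Y ** R + E) *v (z1 - z2) = 0"
    using z E[of z1] E[of z2] by (simp add: matrix_vector_mult_add_rdistrib matrix_vector_mult_diff_distrib)
  then show ?thesis
    using z(3) by (intro det_eq_0_if_kernel[of _ "z1 - z2"]) auto
qed

text \<open>
The polynomial is a bordered determinant \<open>Y \<mapsto> det (Y R + E)\<close>, made square by \<open>R = X\<^sup>* + v u\<^sup>*\<close>.
The positive semidefinite matrix \<open>E\<close> has as kernel the space \<open>S\<close> spanned by \<open>u\<close> and the columns of
\<open>X\<close>, of dimension \<open>rank X + 1\<close>, so the determinant vanishes when \<open>Y\<close> has rank at most that of
\<open>X\<close>. If \<open>B X\<^sup>* = 0\<close>, the matrix at \<open>X + t B\<close> is a rank-one perturbation of the invertible matrix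
\<open>Z = X X\<^sup>* + E + u u\<^sup>*\<close>, and the determinant is exactly linear in \<open>t\<close>.
\<close>

lemma exists_polynomial_with_slope:
  fixes X :: "complex^'n^'m"
  assumes u: "conj_transpose X *v u = 0" "norm u = 1" and v: "X *v v = 0"
  obtains f where "f \<in> vanishing_ideal (rank_variety (rank X))"
    and "\<And>B t. B ** conj_transpose X = 0 \<Longrightarrow> f (X + t *\<^sub>R B) = t * Re (cdot u (B *v v))"
proof -
  define S where "S = vec.span (insert u (range ((*v) X)))"
  have S: "vec.subspace S" "u \<in> S" "\<And>y. X *v y \<in> S"
    by (auto simp: S_def intro: vec.span_base)
  have Xu: "cdot u (X *v y) = 0" for y
    using u(1) by (simp add: cdot_adjoint)
  have uu: "cdot u u = 1"
    using u(2) by (simp add: cdot_self)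
  have spanX: "vec.span (range ((*v) X)) = range ((*v) X)"
    using vec.linear_subspace_image[of "(*v) X" UNIV] by (simp add: vec.span_eq_iff)
  have "u \<notin> range ((*v) X)"
    using Xu uu by auto
  then have dimS: "vec.dim S = Suc (rank X)"
    by (simp add: S_def vec.dim_insert spanX dim_range)
  obtain C :: "complex^'m^'m" where C: "\<And>z. C *v z = 0 \<longleftrightarrow> z \<in> S"
    and "\<And>z. z - C *v z \<in> S"
    by (rule exists_matrix_with_kernel[OF S(1)]) (rule that)
  \<comment> \<open>The product with the adjoint keeps the kernel and makes \<open>E\<close> positive semidefinite.\<close>
  define E where "E = conj_transpose C ** C"
  have E: "E *v z = 0" if "z \<in> S" for z
    using C[of z] that by (simp add: E_def flip: matrix_vector_mul_assoc)
  define R where "R = conj_transpose X + outer v u"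
  define Z where "Z = X ** conj_transpose X + E + outer u u"
  have ctZ: "conj_transpose Z = Z"
    by (simp add: Z_def E_def ct_add ct_mult)
  have Zu: "Z *v u = u"
    using u(1) E[OF S(2)] uu
    by (simp add: Z_def matrix_vector_mult_add_rdistrib outer_mult_vec flip: matrix_vector_mul_assoc)
  have detZ: "det Z \<noteq> 0"
  proof
    assume "det Z = 0"
    then obtain z where z: "z \<noteq> 0" "Z *v z = 0"
      by (rule kernel_if_det_eq_0)
    \<comment> \<open>The three positive semidefinite parts of \<open>Z\<close> have only the zero vector as common kernel.\<close>
    have "cdot z (Z *v z) = cdot (conj_transpose X *v z) (conj_transpose X *v z)
        + cdot (C *v z) (C *v z) + cdot z u * cdot u z"
      by (simp add: Z_def E_def matrix_vector_mult_add_rdistrib outer_mult_vec cdot_add_right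
          cdot_scale_right cdot_adjoint[of z] mult.commute flip: matrix_vector_mul_assoc)
    also have "\<dots> = of_real ((norm (conj_transpose X *v z))\<^sup>2 + (norm (C *v z))\<^sup>2 + (cmod (cdot u z))\<^sup>2)"
      by (simp add: cdot_self cdot_commute[of z u] complex_norm_square[symmetric] mult.commute)
    finally have "of_real ((norm (conj_transpose X *v z))\<^sup>2 + (norm (C *v z))\<^sup>2 + (cmod (cdot u z))\<^sup>2) = (0::complex)"
      using z(2) by simp
    then have "(norm (conj_transpose X *v z))\<^sup>2 + (norm (C *v z))\<^sup>2 + (cmod (cdot u z))\<^sup>2 = 0"
      by (simp only: of_real_eq_0_iff)
    then have zero: "conj_transpose X *v z = 0" "C *v z = 0" "cdot u z = 0"
      by (smt (verit) zero_le_power2 power2_eq_iff_nonneg norm_ge_zero norm_eq_zero zero_eq_power2)+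
    have "z \<in> S"
      using zero(2) C by simp
    then obtain a y where "z = X *v y + a *s u"
      unfolding S_def vec.span_insert spanX by (auto simp: algebra_simps)
    then have "cdot z z = cdot z (X *v y) + a * cdot z u"
      by (metis cdot_add_right cdot_scale_right)
    also have "\<dots> = 0"
      using zero by (simp add: cdot_adjoint cdot_commute[of z u])
    finally show False
      using z(1) by simp
  qed
  have main: "det ((X + t *\<^sub>R B) ** R + E) = of_real t * cdot u (B *v v) * det Z"
    if B: "B ** conj_transpose X = 0" for B t
  proof -
    obtain Z' where Z': "Z ** Z' = mat 1"
      using detZ by (metis invertible_det_nz invertible_right_inverse)
    have "X ** R = X ** conj_transpose X"
      by (simp add: R_def matrix_distribs mult_outer v)
    moreover have "B ** R = outer (B *v v) u"
      by (simp add: R_def matrix_distribs mult_outer B)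
    ultimately have "(X + t *\<^sub>R B) ** R + E = Z + outer (t *\<^sub>R (B *v v) - u) u"
      by (simp add: Z_def matrix_distribs outer_diff_left outer_scaleR_left flip: scalar_matrix_assoc)
    also have "\<dots> = Z ** (mat 1 + outer (Z' *v (t *\<^sub>R (B *v v) - u)) u)"
      by (simp add: matrix_distribs mult_outer matrix_vector_mul_assoc Z')
    also have "det \<dots> = det Z * (1 + cdot u (Z' *v (t *\<^sub>R (B *v v) - u)))"
      by (simp add: det_mul det_mat_1_plus_outer)
    also have "cdot u (Z' *v y) = cdot u y" for y
      using cdot_adjoint[of u Z "Z' *v y"] by (simp add: matrix_vector_mul_assoc Z' ctZ Zu)
    finally show ?thesis
      by (simp add: cdot_diff_right cdot_scaleR_right uu)
  qed
  show ?thesis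
  proof (rule that)
    show "(\<lambda>Y. Re (det (Y ** R + E) * inverse (det Z))) \<in> vanishing_ideal (rank_variety (rank X))"
    proof -
      have "complex_polynomial_function (\<lambda>Y. det (Y ** R + E) * inverse (det Z))"
        by (intro complex_polynomial_function_mult complex_polynomial_function_const
            complex_polynomial_function_det complex_polynomial_function_affine_entry)
      moreover have "det (Y ** R + E) = 0" if "rank Y \<le> rank X" for Y
        using S(1) that E dimS by (intro det_eq_0_if_low_rank[of S]) auto
      ultimately show ?thesis
        by (simp add: vanishing_ideal_def rank_variety_def complex_polynomial_function_def)
    qed
  next
    fix B :: "complex^'n^'m" and t
    assume "B ** conj_transpose X = 0"
    then have "det ((X + t *\<^sub>R B) ** R + E) * inverse (det Z) = of_real t * cdot u (B *v v)"
      using detZ by (simp add: main)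
    then show "Re (det ((X + t *\<^sub>R B) ** R + E) * inverse (det Z)) = t * Re (cdot u (B *v v))"
      by simp
  qed
qed

lemma subspace_normal_space: "subspace (normal_space X)"
  by (rule subspaceI)
    (auto simp: normal_space_def matrix_distribs matrix_scalar_ac simp flip: scalar_matrix_assoc)

text \<open>
If the gradients did not fill the normal space, some nonzero normal \<open>B\<close> would be orthogonal to all
of them. But \<open>v = B\<^sup>* w\<close> and \<open>u\<close> proportional to \<open>B v\<close> are admissible in
\<open>exists_polynomial_with_slope\<close>, and the resulting gradient has inner product \<open>norm (B v)\<close> with \<open>B\<close>.
\<close>

lemma gradients_eq_normal_space:
  fixes X :: "complex^'n^'m"
  shows "gradients_at (rank_variety (rank X)) X = normal_space X" (is "?\<Gamma> = _")
proof (rule subset_antisym)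
  show sub: "?\<Gamma> \<subseteq> normal_space X"
    by (rule gradients_subset_normal_space) simp
  have orth: "B = 0" if B: "B \<in> normal_space X" and perp: "\<And>g. g \<in> ?\<Gamma> \<Longrightarrow> inner B g = 0" for B
  proof (rule ccontr)
    assume "B \<noteq> 0"
    then have "B ** conj_transpose B \<noteq> 0"
      by (simp add: mult_ct_self_eq_0)
    then obtain w where w: "B *v (conj_transpose B *v w) \<noteq> 0"
      by (auto simp: matrix_eq matrix_vector_mul_assoc)
    define v where "v = conj_transpose B *v w"
    define u where "u = inverse (norm (B *v v)) *\<^sub>R (B *v v)"
    have BX: "conj_transpose X ** B = 0" "B ** conj_transpose X = 0" "X ** conj_transpose B = 0"
      using B ct_mult[of B "conj_transpose X"] by (simp_all add: normal_space_def)
    have "norm u = 1"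
      using w by (simp add: u_def v_def)
    moreover have "conj_transpose X *v u = 0"
      by (simp add: u_def matrix_vector_mult_scaleR_complex matrix_vector_mul_assoc BX)
    moreover have "X *v v = 0"
      by (simp add: v_def matrix_vector_mul_assoc BX)
    ultimately obtain f where f: "f \<in> vanishing_ideal (rank_variety (rank X))"
        "\<And>B t. B ** conj_transpose X = 0 \<Longrightarrow> f (X + t *\<^sub>R B) = t * Re (cdot u (B *v v))"
      using exists_polynomial_with_slope by blast
    then obtain g where g: "GDERIV f X :> g"
      using real_polynomial_function_GDERIV unfolding vanishing_ideal_def by blast
    then have "inner B g = Re (cdot u (B *v v))"
      using f(2) BX(2) by (intro GDERIV_on_line)
    moreover have "inner B g = 0"
      using f(1) g by (intro perp) (auto simp: gradients_at_def)
    ultimately show False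
      using w by (simp add: u_def v_def cdot_scaleR_left cdot_self power2_eq_square)
  qed
  show "normal_space X \<subseteq> ?\<Gamma>"
  proof
    fix G assume G: "G \<in> normal_space X"
    obtain y z where yz: "y \<in> span ?\<Gamma>" "\<And>w. w \<in> span ?\<Gamma> \<Longrightarrow> orthogonal z w" "G = y + z"
      using orthogonal_subspace_decomp_exists[of ?\<Gamma> G] by blast
    have y: "y \<in> ?\<Gamma>"
      using yz(1) subspace_gradients_at by (metis span_eq_iff)
    then have "G - y \<in> normal_space X"
      using G sub subspace_normal_space subspace_diff by blast
    then have "G - y = 0"
      using yz by (intro orth) (auto simp: orthogonal_def span_base)
    then show "G \<in> ?\<Gamma>"
      using y by simp
  qed
qed

section \<open>Smooth points and critical points of the rank variety\<close>

lemma kernel_isomorphism: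
  fixes X Y :: "complex^'n^'m"
  assumes "rank X = rank Y"
  obtains T :: "complex^'n^'n"
  where "\<And>z. X *v z = 0 \<Longrightarrow> Y *v (T *v z) = 0" "\<And>z. X *v z = 0 \<Longrightarrow> T *v z = 0 \<Longrightarrow> z = 0"
proof -
  have "vec.dim {z. X *v z = 0} = vec.dim {z. Y *v z = 0}"
    using dim_kernel[of X] dim_kernel[of Y] assms by linarith
  then obtain f where f: "Vector_Spaces.linear (*s) (*s) f" "f ` {z. X *v z = 0} = {z. Y *v z = 0}"
      "inj_on f {z. X *v z = 0}"
    using vec.subspace_isomorphism[OF subspace_kernel subspace_kernel] by blast
  have f0: "f 0 = 0"
    using f(1) by (metis matrix_works vec.zero)
  show ?thesis
  proof (rule that[of "matrix f"])
    fix z assume z: "X *v z = 0"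
    then show "Y *v (matrix f *v z) = 0"
      using f(1,2) by (auto simp: matrix_works)
    assume "matrix f *v z = 0"
    then have "f z = f 0"
      using f(1) f0 by (simp add: matrix_works)
    then show "z = 0"
      using f(3) z by (auto dest: inj_onD)
  qed
qed

lemma matrix_mult_eq_0_iff: "A ** B = 0 \<longleftrightarrow> (\<forall>z. A *v (B *v z) = 0)" for A :: "complex^'n^'m"
  by (simp add: matrix_eq matrix_vector_mul_assoc)

text \<open>
The matrix \<open>G\<close> is normal at \<open>X\<close> iff it maps into the kernel of \<open>X\<^sup>*\<close> and \<open>G\<^sup>*\<close> maps into the
kernel of \<open>X\<close>. Isomorphisms \<open>S\<close> and \<open>T\<close> from these two kernels to those of \<open>Y\<^sup>*\<close> and \<open>Y\<close> exist by
rank-nullity, and \<open>S G T\<^sup>*\<close> is normal at \<open>Y\<close>.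
\<close>

lemma dim_normal_space_le:
  fixes X Y :: "complex^'n^'m"
  assumes "rank X = rank Y"
  shows "dim (normal_space X) \<le> dim (normal_space Y)"
proof -
  obtain S where S: "\<And>z. conj_transpose X *v z = 0 \<Longrightarrow> conj_transpose Y *v (S *v z) = 0"
      "\<And>z. conj_transpose X *v z = 0 \<Longrightarrow> S *v z = 0 \<Longrightarrow> z = 0"
    using kernel_isomorphism[of "conj_transpose X" "conj_transpose Y"] assms by auto
  obtain T where T: "\<And>z. X *v z = 0 \<Longrightarrow> Y *v (T *v z) = 0" "\<And>z. X *v z = 0 \<Longrightarrow> T *v z = 0 \<Longrightarrow> z = 0"
    using kernel_isomorphism[OF assms] by blast
  define \<Phi> where "\<Phi> G = S ** G ** conj_transpose T" for G :: "complex^'n^'m"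
  have lin: "linear \<Phi>"
    by (rule linearI) (simp_all add: \<Phi>_def matrix_distribs matrix_scalar_ac flip: scalar_matrix_assoc)
  have ker: "conj_transpose X ** G = 0 \<and> X ** conj_transpose G = 0" if "G \<in> normal_space X" for G
    using that ct_mult[of G "conj_transpose X"] by (simp add: normal_space_def)
  have "inj_on \<Phi> (normal_space X)"
  proof (rule linear_inj_on_iff_eq_0[OF lin subspace_normal_space, THEN iffD2], intro ballI impI)
    fix G assume G: "G \<in> normal_space X" and 0: "\<Phi> G = 0"
    have "S *v (G *v (conj_transpose T *v z)) = 0" for z
      using 0 by (simp add: \<Phi>_def matrix_vector_mul_assoc matrix_mul_assoc)
    moreover have "conj_transpose X *v (G *v (conj_transpose T *v z)) = 0" for z
      using ker[OF G] by (simp add: matrix_mult_eq_0_iff)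
    ultimately have "G ** conj_transpose T = 0"
      using S(2) by (simp add: matrix_mult_eq_0_iff)
    then have "T ** conj_transpose G = 0"
      using ct_mult[of G "conj_transpose T"] by simp
    then have "conj_transpose G *v z = 0" for z
      using ker[OF G] T(2) by (simp add: matrix_mult_eq_0_iff)
    then have "conj_transpose G = 0"
      by (simp add: matrix_eq)
    then show "G = 0"
      by simp
  qed
  moreover have "\<Phi> ` normal_space X \<subseteq> normal_space Y"
  proof clarify
    fix G assume G: "G \<in> normal_space X"
    have "conj_transpose Y ** (S ** G) = 0"
      using ker[OF G] S(1) by (simp add: matrix_mult_eq_0_iff flip: matrix_vector_mul_assoc)
    moreover have "Y ** (T ** conj_transpose G) = 0"
      using ker[OF G] T(1) by (simp add: matrix_mult_eq_0_iff flip: matrix_vector_mul_assoc)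
    then have "(G ** conj_transpose T) ** conj_transpose Y = 0"
      using ct_mult[of Y "T ** conj_transpose G"] by (simp add: ct_mult)
    ultimately show "\<Phi> G \<in> normal_space Y"
      by (simp add: \<Phi>_def normal_space_def matrix_mul_assoc)
        (metis matrix_mul_assoc times0_right)
  qed
  ultimately show ?thesis
    using dim_image_eq[OF lin, of "normal_space X"] dim_subset[of "\<Phi> ` normal_space X" "normal_space Y"]
      subspace_normal_space by (metis span_eq_iff)
qed

text \<open>
The Jacobian rank is the dimension of the normal space, the same for all matrices of rank \<open>k\<close>, and
0 at the matrices of smaller rank.
\<close>

lemma smooth_points_rank_variety:
  fixes X :: "complex^'n^'m"
  assumes "rank X = k"
  shows "X \<in> smooth_points (rank_variety k)"
proof -
  have "jacobian_rank (rank_variety k) Y \<le> jacobian_rank (rank_variety k) X" if "rank Y \<le> k"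
    for Y :: "complex^'n^'m"
  proof (cases "rank Y = k")
    case True
    then show ?thesis
      using dim_normal_space_le[of Y X] gradients_eq_normal_space[of X] gradients_eq_normal_space[of Y] assms
      by (simp add: jacobian_rank_def)
  next
    case False
    then show ?thesis
      using that gradients_lower_rank[of Y k] by (simp add: jacobian_rank_def)
  qed
  then show ?thesis
    using assms by (simp add: smooth_points_def rank_variety_def)
qed

text \<open>
The condition on \<open>k\<close> excludes points of smaller rank: there the tangent space is everything, so
a critical point would equal \<open>A\<close>, whose rank is at least \<open>k\<close>.
\<close>

lemma critical_iff_residual_normal:
  fixes A :: "complex^'n^'m"
  assumes "k \<le> rank A"
  shows "hermitian_critical_points A (rank_variety k) = {X. rank X = k \<and> A - X \<in> normal_space X}"
proof (intro set_eqI iffI)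
  fix X assume X: "X \<in> hermitian_critical_points A (rank_variety k)"
  then have le: "rank X \<le> k"
    by (simp add: hermitian_critical_points_def smooth_points_def rank_variety_def)
  have perp: "inner B (A - X) = 0" if "B \<in> tangent_space (rank_variety k) X" for B
    using X that inner_matrix[of "A - X" B] by (simp add: hermitian_critical_points_def inner_commute[of B])
  have "rank X = k"
  proof (rule ccontr)
    assume "rank X \<noteq> k"
    with le have lt: "rank X < k"
      by simp
    then have "A - X \<in> tangent_space (rank_variety k) X"
      by (simp add: tangent_space_def gradients_lower_rank)
    then have "A = X"
      using perp[of "A - X"] by simp
    then show False
      using lt assms by simp
  qed
  moreover have "X ** C \<in> tangent_space (rank_variety k) X" "C' ** X \<in> tangent_space (rank_variety k) X" for C C'
    using gradients_orthogonal_mult[OF le] by (auto simp: tangent_space_def)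
  ultimately show "X \<in> {X. rank X = k \<and> A - X \<in> normal_space X}"
    using perp by (blast intro: normal_spaceI)
next
  fix X assume X: "X \<in> {X. rank X = k \<and> A - X \<in> normal_space X}"
  then have "A - X \<in> gradients_at (rank_variety k) X"
    using gradients_eq_normal_space[of X] by auto
  then have "Re (trace ((A - X) ** conj_transpose B)) = 0" if "B \<in> tangent_space (rank_variety k) X" for B
    using that by (simp add: tangent_space_def inner_commute[of B] flip: inner_matrix)
  then show "X \<in> hermitian_critical_points A (rank_variety k)"
    using X smooth_points_rank_variety by (auto simp: hermitian_critical_points_def)
qed

section \<open>Diagonalising a projection inside the blocks of a diagonal matrix\<close>

definition diag_matrix :: "('n \<Rightarrow> complex) \<Rightarrow> complex^'n^'n" where
  "diag_matrix f = (\<chi> a b. if a = b then f a else 0)"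

lemma mult_diag_nth: "(A ** diag_matrix f) $ a $ b = A $ a $ b * f b"
  by (simp add: diag_matrix_def matrix_matrix_mult_def if_distrib cong: if_cong)

lemma diag_mult_nth: "(diag_matrix f ** A) $ a $ b = f a * A $ a $ b"
  by (simp add: diag_matrix_def matrix_matrix_mult_def if_distrib if_distribR cong: if_cong)

lemma diag_matrix_commute:
  assumes "\<And>a b. A $ a $ b \<noteq> 0 \<Longrightarrow> f a = f b"
  shows "A ** diag_matrix f = diag_matrix f ** A"
proof -
  have "A $ a $ b * f b = f a * A $ a $ b" for a b
    using assms[of a b] by (cases "A $ a $ b = 0") auto
  then show ?thesis
    by (simp add: vec_eq_iff mult_diag_nth diag_mult_nth)
qed

text \<open>
The vectors \<open>q i\<close> are found one at a time. The level set of \<open>d\<close> through \<open>i\<close> contains more indices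
than there are vectors chosen in it, so a linear system with fewer equations than unknowns provides
a nonzero \<open>w\<close> supported on that level set and orthogonal to all previous vectors. Since these are
eigenvectors of \<open>P\<close>, the vector \<open>P w\<close> is again orthogonal to them, and one of \<open>P w\<close> and \<open>w\<close> is a
nonzero eigenvector of \<open>P\<close>.
\<close>

lemma orthonormal_block_eigenvectors:
  fixes P :: "complex^'n^'n" and d :: "'n \<Rightarrow> 'a"
  assumes herm: "conj_transpose P = P" and idem: "P ** P = P"
    and block: "\<And>a b. P $ a $ b \<noteq> 0 \<Longrightarrow> d a = d b"
    and "finite F"
  shows "\<exists>q. (\<forall>i\<in>F. \<forall>a. q i $ a \<noteq> 0 \<longrightarrow> d a = d i) \<and> (\<forall>i\<in>F. P *v q i = q i \<or> P *v q i = 0) \<and>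
     (\<forall>i\<in>F. \<forall>j\<in>F. cdot (q i) (q j) = (if i = j then 1 else 0))"
  using \<open>finite F\<close>
proof induction
  case (insert i F)
  then obtain q where q: "\<And>j a. j \<in> F \<Longrightarrow> q j $ a \<noteq> 0 \<Longrightarrow> d a = d j"
      "\<And>j. j \<in> F \<Longrightarrow> P *v q j = q j \<or> P *v q j = 0"
      "\<And>j l. j \<in> F \<Longrightarrow> l \<in> F \<Longrightarrow> cdot (q j) (q l) = (if j = l then 1 else 0)"
    by blast
  \<comment> \<open>The equation numbered \<open>b\<close> forces \<open>b\<close> out of the support if \<open>d b \<noteq> d i\<close>, asks for orthogonality
    to \<open>q b\<close> if that vector is chosen, and is void otherwise, in particular for \<open>b = i\<close>.\<close>
  define M :: "complex^'n^'n" where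
    "M = (\<chi> b a. if d b \<noteq> d i then (if a = b then 1 else 0) else if b \<in> F then cnj (q b $ a) else 0)"
  have "row i M = 0"
    using insert.hyps by (simp add: vec_eq_iff row_def M_def)
  then have "det M = 0"
    by (rule det_zero_row)
  then obtain w where w: "w \<noteq> 0" "M *v w = 0"
    by (rule kernel_if_det_eq_0)
  then have Mw: "(\<Sum>a\<in>UNIV. M $ b $ a * w $ a) = 0" for b
    by (simp add: vec_eq_iff matrix_vector_mult_def)
  have w_block: "d a = d i" if "w $ a \<noteq> 0" for a
  proof (rule ccontr)
    assume "d a \<noteq> d i"
    then have "M $ a $ c * w $ c = (if c = a then w $ c else 0)" for c
      by (simp add: M_def)
    then show False
      using Mw[of a] that by simp
  qed
  have w_perp: "cdot (q j) w = 0" if j: "j \<in> F" for j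
  proof (cases "d j = d i")
    case True
    then show ?thesis
      using Mw[of j] j by (simp add: M_def cdot_def)
  next
    case False
    then have "cnj (q j $ a) * w $ a = 0" for a
      using q(1)[OF j] w_block by fastforce
    then show ?thesis
      unfolding cdot_def by (intro sum.neutral) blast
  qed
  define w' where "w' = (if P *v w = 0 then w else P *v w)"
  have w'0: "w' \<noteq> 0"
    using w(1) by (simp add: w'_def)
  have w'_block: "d a = d i" if "w' $ a \<noteq> 0" for a
  proof (cases "P *v w = 0")
    case False
    then have "(\<Sum>b\<in>UNIV. P $ a $ b * w $ b) \<noteq> 0"
      using that by (simp add: w'_def matrix_vector_mult_def)
    then obtain b where "P $ a $ b * w $ b \<noteq> 0"
      by (meson sum.not_neutral_contains_not_neutral)
    then show ?thesis
      using block[of a b] w_block[of b] by simp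
  qed (use that w_block in \<open>simp add: w'_def\<close>)
  have w'_perp: "cdot (q j) w' = 0" if j: "j \<in> F" for j
    using w_perp[OF j] q(2)[OF j] by (auto simp: w'_def cdot_adjoint herm)
  have w'_eig: "P *v w' = w' \<or> P *v w' = 0"
    by (simp add: w'_def matrix_vector_mul_assoc idem)
  define v where "v = inverse (norm w') *\<^sub>R w'"
  have v_eig: "P *v v = v \<or> P *v v = 0"
    using w'_eig by (auto simp: v_def matrix_vector_mult_scaleR_complex)
  have v_block: "v $ a \<noteq> 0 \<Longrightarrow> d a = d i" for a
    using w'_block[of a] by (auto simp: v_def)
  have v_perp: "cdot (q j) v = 0" "cdot v (q j) = 0" if "j \<in> F" for j
    using w'_perp[OF that] by (simp_all add: v_def cdot_scaleR_right cdot_scaleR_left cdot_commute[of w'])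
  have vv: "cdot v v = 1"
    using w'0 by (simp add: cdot_self v_def)
  show ?case
    using insert.hyps q v_eig v_block v_perp vv by (intro exI[of _ "q(i := v)"]) auto
qed auto

lemma projection_diagonalizable_in_blocks:
  fixes P :: "complex^'n^'n" and d :: "'n \<Rightarrow> 'a"
  assumes "conj_transpose P = P" and "P ** P = P"
    and "\<And>a b. P $ a $ b \<noteq> 0 \<Longrightarrow> d a = d b"
  obtains Q E where "unitary_matrix Q" "\<And>a b. Q $ a $ b \<noteq> 0 \<Longrightarrow> d a = d b"
    "P = Q ** diag_matrix (\<lambda>a. if a \<in> E then 1 else 0) ** conj_transpose Q"
proof -
  obtain q where q: "\<And>j a. q j $ a \<noteq> 0 \<Longrightarrow> d a = d j"
      "\<And>j. P *v q j = q j \<or> P *v q j = 0"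
      "\<And>j l. cdot (q j) (q l) = (if j = l then 1 else 0)"
  proof -
    have "\<exists>q. (\<forall>i\<in>UNIV. \<forall>a. q i $ a \<noteq> 0 \<longrightarrow> d a = d i) \<and>
        (\<forall>i\<in>UNIV. P *v q i = q i \<or> P *v q i = 0) \<and>
        (\<forall>i\<in>UNIV. \<forall>j\<in>UNIV. cdot (q i) (q j) = (if i = j then 1 else 0))"
      by (rule orthonormal_block_eigenvectors) (use assms in auto)
    then show ?thesis
      using that by auto
  qed
  define Q where "Q = (\<chi> a j. q j $ a)"
  define E where "E = {j. P *v q j = q j}"
  let ?D = "diag_matrix (\<lambda>a. if a \<in> E then 1 else 0)"
  have "conj_transpose Q ** Q = mat 1"
    using q(3) by (simp add: vec_eq_iff Q_def mat_def matrix_matrix_mult_def cdot_def)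
  then have U: "unitary_matrix Q"
    by (simp add: unitary_matrix_def matrix_left_right_inverse)
  have "P ** Q = Q ** ?D"
  proof -
    have "(P ** Q) $ a $ j = (P *v q j) $ a" for a j
      by (simp add: matrix_matrix_mult_def matrix_vector_mult_def Q_def)
    moreover have "(P *v q j) $ a = (Q ** ?D) $ a $ j" for a j
      using q(2)[of j] by (auto simp: mult_diag_nth Q_def E_def)
    ultimately show ?thesis
      by (simp add: vec_eq_iff)
  qed
  then have "P = Q ** ?D ** conj_transpose Q"
    using U by (metis matrix_mul_assoc matrix_mul_rid unitary_matrix_def)
  then show ?thesis
    using U q(1) by (intro that[of Q E]) (auto simp: Q_def)
qed

section \<open>Rectangular diagonal matrices and singular value decompositions\<close>

lemma sum_single_diag:
  assumes "finite I"
  shows "(\<Sum>i\<in>I. single_diag \<rho> \<kappa> s i) = rect_diag \<rho> \<kappa> (\<lambda>j. if j \<in> I then s j else 0)"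
proof -
  have "(\<Sum>i\<in>I. single_diag \<rho> \<kappa> s i $ a $ b) = (\<Sum>i\<in>I. if \<rho> a = i then (if \<rho> a = \<kappa> b then of_real (s i) else 0) else 0)"
    for a b
    by (intro sum.cong) (auto simp: single_diag_def rect_diag_def)
  then show ?thesis
    using assms by (simp add: vec_eq_iff rect_diag_def)
qed

lemma rect_diag_orthogonal:
  assumes "\<And>i. f i * g i = 0"
  shows "conj_transpose (rect_diag \<rho> \<kappa> f) ** rect_diag \<rho> \<kappa> g = 0"
    and "rect_diag \<rho> \<kappa> f ** conj_transpose (rect_diag \<rho> \<kappa> g) = 0"
proof -
  have fg: "f i = 0 \<or> g i = 0" for i
    using assms[of i] by simp
  show "conj_transpose (rect_diag \<rho> \<kappa> f) ** rect_diag \<rho> \<kappa> g = 0"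
    using fg by (auto simp: vec_eq_iff matrix_matrix_mult_def rect_diag_def intro!: sum.neutral)
  show "rect_diag \<rho> \<kappa> f ** conj_transpose (rect_diag \<rho> \<kappa> g) = 0"
    using fg by (auto simp: vec_eq_iff matrix_matrix_mult_def rect_diag_def intro!: sum.neutral)
qed

lemma unitary_cancel:
  assumes "unitary_matrix U"
  shows "U ** (conj_transpose U ** A) = A" "conj_transpose U ** (U ** B) = B"
  using assms by (simp_all add: unitary_matrix_def matrix_mul_assoc)

lemma unitary_mult: "unitary_matrix U \<Longrightarrow> unitary_matrix V \<Longrightarrow> unitary_matrix (U ** V)"
  by (auto simp: unitary_matrix_def ct_mult matrix_mul_assoc) (metis matrix_mul_assoc matrix_mul_rid)+

lemma rank_sum_le: "finite I \<Longrightarrow> rank (sum f I) \<le> (\<Sum>i\<in>I. rank (f i))"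
  for f :: "'b \<Rightarrow> complex^'n^'m"
proof (induction I rule: finite_induct)
  case empty
  show ?case
    using rank_le_iff_sum_outer[of "0 :: complex^'n^'m" 0] by simp
next
  case (insert x I)
  then show ?case
    using rank_add_le[of "f x" "sum f I"] by simp
qed

lemma rank_single_diag_le: "rank (single_diag \<rho> \<kappa> s i) \<le> 1"
proof -
  have "single_diag \<rho> \<kappa> s i =
      outer (\<chi> a. if \<rho> a = i then of_real (s i) else 0) (\<chi> b. if \<kappa> b = i then 1 else 0)"
    by (auto simp: single_diag_def rect_diag_def outer_def vec_eq_iff)
  then show ?thesis
    using rank_outer_le by metis
qed

lemma rank_unitary_mult_le: "rank (U ** X ** W) \<le> rank X" for X :: "complex^'n^'m"
  using rank_mult_le_left[of "U ** X" W] rank_mult_le_right[of U X] by simp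

section \<open>Partial sums of a singular value decomposition\<close>

text \<open>
Each summand has rank at most one, which bounds the rank above. The lower bound comes from
subadditivity: \<open>A\<close>, of rank \<open>r\<close>, is the sum of the partial sums over \<open>I\<close> and over its complement.
\<close>

lemma rank_partial_svd:
  fixes A :: "complex^'n^'m"
  assumes svd: "is_svd \<rho> \<kappa> A r U s V" and r: "rank A = r" and I: "I \<subseteq> {1..r}"
    and \<rho>: "\<And>a. 1 \<le> \<rho> a"
  shows "rank (U ** (\<Sum>i\<in>I. single_diag \<rho> \<kappa> s i) ** conj_transpose V) = card I"
proof -
  let ?X = "\<lambda>I. U ** (\<Sum>i\<in>I. single_diag \<rho> \<kappa> s i) ** conj_transpose V"
  have le: "rank (?X J) \<le> card J" if "finite J" for J
  proof -
    have "rank (?X J) \<le> rank (\<Sum>i\<in>J. single_diag \<rho> \<kappa> s i :: complex^'n^'m)"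
      by (rule rank_unitary_mult_le)
    also have "\<dots> \<le> (\<Sum>i\<in>J. rank (single_diag \<rho> \<kappa> s i :: complex^'n^'m))"
      using that by (rule rank_sum_le)
    also have "\<dots> \<le> (\<Sum>i\<in>J. 1)"
      by (intro sum_mono rank_single_diag_le)
    finally show ?thesis by simp
  qed
  have fin: "finite I"
    using I finite_subset by blast
  have "rect_diag \<rho> \<kappa> (\<lambda>i. if i \<le> r then s i else 0) = rect_diag \<rho> \<kappa> (\<lambda>i. if i \<in> {1..r} then s i else 0)"
    using \<rho> by (simp add: rect_diag_def vec_eq_iff)
  also have "\<dots> = (\<Sum>i\<in>I. single_diag \<rho> \<kappa> s i) + (\<Sum>i\<in>{1..r} - I. single_diag \<rho> \<kappa> s i)"
    using sum.subset_diff[OF I finite_atLeastAtMost, of "single_diag \<rho> \<kappa> s"]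
    by (simp only: sum_single_diag[OF finite_atLeastAtMost] add.commute)
  finally have "A = ?X I + ?X ({1..r} - I)"
    using svd by (simp add: is_svd_def matrix_distribs)
  then have "r \<le> rank (?X I) + rank (?X ({1..r} - I))"
    using r rank_add_le by metis
  moreover have "card ({1..r} - I) = r - card I"
    using I fin by (simp add: card_Diff_subset)
  moreover have "card I \<le> r"
    using I card_mono[of "{1..r}" I] by simp
  ultimately show ?thesis
    using le[OF fin] le[of "{1..r} - I"] by simp
qed

lemma partial_svd_residual_normal:
  fixes A :: "complex^'n^'m"
  assumes svd: "is_svd \<rho> \<kappa> A r U s V" and I: "I \<subseteq> {1..r}" and \<rho>: "\<And>a. 1 \<le> \<rho> a"
  shows "A - U ** (\<Sum>i\<in>I. single_diag \<rho> \<kappa> s i) ** conj_transpose V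
     \<in> normal_space (U ** (\<Sum>i\<in>I. single_diag \<rho> \<kappa> s i) ** conj_transpose V)"
proof -
  let ?S = "rect_diag \<rho> \<kappa> (\<lambda>j. if j \<in> I then s j else 0) :: complex^'n^'m"
  let ?N = "rect_diag \<rho> \<kappa> (\<lambda>i. if i \<in> {1..r} - I then s i else 0) :: complex^'n^'m"
  have U: "unitary_matrix U" and V: "unitary_matrix V"
    using svd by (auto simp: is_svd_def)
  have fin: "finite I"
    using I finite_subset by blast
  have "rect_diag \<rho> \<kappa> (\<lambda>i. if i \<le> r then s i else 0) - ?S = ?N"
    using \<rho> I by (auto simp: rect_diag_def vec_eq_iff)
  then have N: "A - U ** ?S ** conj_transpose V = U ** ?N ** conj_transpose V"
    using svd by (simp add: is_svd_def matrix_distribs[symmetric])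
  have "conj_transpose ?S ** ?N = 0"
    by (rule rect_diag_orthogonal) simp
  then have "conj_transpose (U ** ?S ** conj_transpose V) ** (U ** ?N ** conj_transpose V) = 0"
    by (simp add: ct_mult unitary_cancel[OF U] flip: matrix_mul_assoc)
      (simp add: matrix_mul_assoc)
  moreover have "?N ** conj_transpose ?S = 0"
    by (rule rect_diag_orthogonal) simp
  then have "(U ** ?N ** conj_transpose V) ** conj_transpose (U ** ?S ** conj_transpose V) = 0"
    by (simp add: ct_mult unitary_cancel[OF V] flip: matrix_mul_assoc)
      (simp add: matrix_mul_assoc)
  ultimately show ?thesis
    by (simp add: normal_space_def sum_single_diag[OF fin] N)
qed

section \<open>Solving the equations of a normal residual\<close>

lemma residual_normal_in_diagonal_frame:
  fixes A :: "complex^'n^'m"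
  assumes U: "unitary_matrix U" and V: "unitary_matrix V"
    and A: "A = U ** \<Sigma> ** conj_transpose V" and X: "A - X \<in> normal_space X"
  defines "Y \<equiv> conj_transpose U ** X ** V"
  shows "conj_transpose Y ** \<Sigma> = conj_transpose Y ** Y" "\<Sigma> ** conj_transpose Y = Y ** conj_transpose Y"
    and "X = U ** Y ** conj_transpose V"
proof -
  have X': "conj_transpose X ** A = conj_transpose X ** X" "A ** conj_transpose X = X ** conj_transpose X"
    using X by (simp_all add: normal_space_def matrix_diff_ldistrib matrix_diff_rdistrib)
  have \<Sigma>: "\<Sigma> = conj_transpose U ** A ** V"
    unfolding A by (simp add: unitary_cancel[OF U] unitary_cancel[OF V] flip: matrix_mul_assoc)
      (use V in \<open>simp add: unitary_matrix_def\<close>)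
  have "conj_transpose Y ** \<Sigma> = conj_transpose V ** (conj_transpose X ** A) ** V"
    unfolding \<Sigma> Y_def by (simp add: ct_mult unitary_cancel[OF U] flip: matrix_mul_assoc)
  also have "\<dots> = conj_transpose Y ** Y"
    unfolding X' Y_def by (simp add: ct_mult unitary_cancel[OF U] flip: matrix_mul_assoc)
  finally show "conj_transpose Y ** \<Sigma> = conj_transpose Y ** Y" .
  have "\<Sigma> ** conj_transpose Y = conj_transpose U ** (A ** conj_transpose X) ** U"
    unfolding \<Sigma> Y_def by (simp add: ct_mult unitary_cancel[OF V] flip: matrix_mul_assoc)
  also have "\<dots> = Y ** conj_transpose Y"
    unfolding X' Y_def by (simp add: ct_mult unitary_cancel[OF V] flip: matrix_mul_assoc)
  finally show "\<Sigma> ** conj_transpose Y = Y ** conj_transpose Y" .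
  show "X = U ** Y ** conj_transpose V"
    unfolding Y_def by (simp add: unitary_cancel[OF U] unitary_cancel[OF V] flip: matrix_mul_assoc)
      (use V in \<open>simp add: unitary_matrix_def\<close>)
qed

text \<open>
The partial isometry \<open>J\<close> in the polar decomposition \<open>\<Sigma> = J D\<close> with \<open>D\<close> square diagonal. It lets
\<open>\<Sigma>\<close> be treated by square matrices indexed by the columns.
\<close>

definition diag_frame :: "('m::finite \<Rightarrow> nat) \<Rightarrow> ('n::finite \<Rightarrow> nat) \<Rightarrow> nat \<Rightarrow> complex^'n^'m" where
  "diag_frame \<rho> \<kappa> r = rect_diag \<rho> \<kappa> (\<lambda>i. if i \<le> r then 1 else 0)"

lemma frame_gram:
  fixes \<rho> :: "'m::finite \<Rightarrow> nat" and \<kappa> :: "'n::finite \<Rightarrow> nat"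
  assumes \<rho>: "bij_betw \<rho> UNIV {1..CARD('m)}" and \<kappa>: "bij_betw \<kappa> UNIV {1..CARD('n)}" and r: "r \<le> CARD('m)"
  shows "conj_transpose (diag_frame \<rho> \<kappa> r) ** diag_frame \<rho> \<kappa> r
      = diag_matrix (\<lambda>b. if \<kappa> b \<le> r then 1 else 0)"
proof -
  have "(\<Sum>a\<in>UNIV. cnj (diag_frame \<rho> \<kappa> r $ a $ b) * diag_frame \<rho> \<kappa> r $ a $ c)
      = (if b = c then if \<kappa> b \<le> r then 1 else 0 else 0)" for b c
  proof (cases "b = c \<and> \<kappa> b \<le> r")
    case True
    have "\<kappa> b \<in> {1..CARD('m)}"
      using True \<kappa> r by (auto simp: bij_betw_def)
    then obtain a0 where a0: "\<rho> a0 = \<kappa> b"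
      using \<rho> by (metis bij_betw_def imageE)
    then have "\<rho> a \<noteq> \<kappa> b" if "a \<noteq> a0" for a
      using \<rho> that by (metis bij_betw_def inj_def)
    then have "cnj (diag_frame \<rho> \<kappa> r $ a $ b) * diag_frame \<rho> \<kappa> r $ a $ c = (if a = a0 then 1 else 0)" for a
      using True a0 by (auto simp: diag_frame_def rect_diag_def)
    then show ?thesis
      using True by auto
  next
    case False
    have "\<kappa> b = \<kappa> c \<Longrightarrow> b = c"
      using \<kappa> by (metis bij_betw_def inj_def)
    then have "cnj (diag_frame \<rho> \<kappa> r $ a $ b) * diag_frame \<rho> \<kappa> r $ a $ c = 0" for a
      using False by (auto simp: diag_frame_def rect_diag_def)
    then have "(\<Sum>a\<in>UNIV. cnj (diag_frame \<rho> \<kappa> r $ a $ b) * diag_frame \<rho> \<kappa> r $ a $ c) = 0"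
      by (intro sum.neutral) blast
    then show ?thesis
      using False by auto
  qed
  then show ?thesis
    by (simp add: vec_eq_iff matrix_matrix_mult_def diag_matrix_def)
qed

lemma ct_diag_real: "conj_transpose (diag_matrix (\<lambda>b. of_real (f b))) = diag_matrix (\<lambda>b. of_real (f b))"
  by (auto simp: vec_eq_iff diag_matrix_def)

text \<open>
Here \<open>J D\<close> is the polar decomposition of \<open>\<Sigma>\<close> and \<open>K = J\<^sup>* J\<close> its support projection. The equations
show that \<open>Y = J T\<close> with \<open>T = J\<^sup>* Y\<close> supported on \<open>K\<close>, and that \<open>T\<^sup>* D = D T\<close> and
\<open>D T\<^sup>* = T D\<close>. Eliminating \<open>T\<^sup>*\<close> gives \<open>D\<^sup>2 T = T D\<^sup>2\<close>, so \<open>T\<close> links only equal entries of \<open>d\<close>,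
and \<open>T\<close> is Hermitian. Dividing the columns of \<open>T\<close> by the positive entries of \<open>d\<close> gives \<open>P\<close>, and
\<open>T\<^sup>* T = T\<^sup>* D\<close> says that \<open>P\<close> is idempotent.
\<close>

lemma polar_factor_is_projection:
  fixes Y J :: "complex^'n^'m" and d :: "'n \<Rightarrow> real"
  assumes d: "\<And>b. 0 \<le> d b"
    and J: "conj_transpose J ** J = diag_matrix (\<lambda>b. if d b = 0 then 0 else 1)"
    and JK: "J ** diag_matrix (\<lambda>b. if d b = 0 then 0 else 1) = J"
    and eq: "conj_transpose Y ** (J ** diag_matrix (\<lambda>b. of_real (d b))) = conj_transpose Y ** Y"
      "(J ** diag_matrix (\<lambda>b. of_real (d b))) ** conj_transpose Y = Y ** conj_transpose Y"
  obtains P where "conj_transpose P = P" "P ** P = P" "\<And>a b. P $ a $ b \<noteq> 0 \<Longrightarrow> d a = d b \<and> d b \<noteq> 0"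
    "Y = J ** diag_matrix (\<lambda>b. of_real (d b)) ** P"
proof -
  define K :: "complex^'n^'n" where "K = diag_matrix (\<lambda>b. if d b = 0 then 0 else 1)"
  define D :: "complex^'n^'n" where "D = diag_matrix (\<lambda>b. of_real (d b))"
  have ctD: "conj_transpose D = D"
    by (simp add: D_def ct_diag_real)
  have ctK: "conj_transpose K = K"
    by (auto simp: vec_eq_iff K_def diag_matrix_def)
  have KD: "K ** D = D" "D ** K = D"
    by (auto simp: vec_eq_iff K_def D_def diag_mult_nth mult_diag_nth) (auto simp: diag_matrix_def)
  have J: "conj_transpose J ** J = K" and JK: "J ** K = J"
    using assms(2,3) by (simp_all add: K_def)
  have KJ: "K ** conj_transpose J = conj_transpose J"
    using JK ctK by (metis ct_mult)
  note eq = eq[folded D_def]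
  define T where "T = conj_transpose J ** Y"
  have YK: "Y ** K = Y"
  proof -
    \<comment> \<open>\<open>Y\<^sup>*\<close> annihilates the difference, so the difference has Gram matrix zero.\<close>
    let ?W = "Y - Y ** K"
    have "conj_transpose Y ** ?W = 0"
    proof -
      have "conj_transpose Y ** (Y ** K) = (conj_transpose Y ** (J ** D)) ** K"
        unfolding eq(1) by (rule matrix_mul_assoc)
      also have "\<dots> = conj_transpose Y ** (J ** (D ** K))"
        by (simp only: matrix_mul_assoc)
      also have "\<dots> = conj_transpose Y ** Y"
        by (simp only: KD(2) eq(1))
      finally show ?thesis
        by (simp add: matrix_diff_ldistrib)
    qed
    moreover have "conj_transpose ?W = conj_transpose Y - K ** conj_transpose Y"
      by (simp add: ct_diff ct_mult ctK)
    then have "conj_transpose ?W ** ?W = conj_transpose Y ** ?W - K ** (conj_transpose Y ** ?W)"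
      by (simp only: matrix_diff_rdistrib matrix_mul_assoc)
    ultimately have "conj_transpose ?W ** ?W = 0"
      by simp
    then show ?thesis
      by (simp add: ct_mult_self_eq_0)
  qed
  have LY: "J ** conj_transpose J ** Y = Y"
  proof -
    let ?W = "Y - J ** conj_transpose J ** Y"
    have "J ** conj_transpose J ** (J ** D) = J ** (conj_transpose J ** J) ** D"
      by (simp add: matrix_mul_assoc)
    then have JD: "J ** conj_transpose J ** (J ** D) = J ** D"
      unfolding J JK .
    have "J ** conj_transpose J ** Y ** conj_transpose Y = J ** conj_transpose J ** ((J ** D) ** conj_transpose Y)"
      unfolding eq(2) by (simp add: matrix_mul_assoc)
    also have "\<dots> = (J ** conj_transpose J ** (J ** D)) ** conj_transpose Y"
      by (simp add: matrix_mul_assoc)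
    also have "\<dots> = Y ** conj_transpose Y"
      unfolding JD eq(2) ..
    finally have "?W ** conj_transpose Y = 0"
      by (simp add: matrix_diff_rdistrib)
    moreover have "conj_transpose ?W = conj_transpose Y - conj_transpose Y ** (J ** conj_transpose J)"
      by (simp add: ct_diff ct_mult)
    then have "?W ** conj_transpose ?W = ?W ** conj_transpose Y - (?W ** conj_transpose Y) ** (J ** conj_transpose J)"
      by (simp only: matrix_diff_ldistrib matrix_mul_assoc)
    ultimately have "?W ** conj_transpose ?W = 0"
      by simp
    then show ?thesis
      by (simp only: mult_ct_self_eq_0) simp
  qed
  then have Y: "Y = J ** T"
    by (simp add: T_def matrix_mul_assoc)
  have KT: "K ** T = T"
    by (simp add: T_def matrix_mul_assoc KJ)
  have TK: "T ** K = T"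
    by (simp add: T_def YK flip: matrix_mul_assoc)
  have ctT: "conj_transpose T = conj_transpose Y ** J"
    by (simp add: T_def ct_mult)
  have TT: "conj_transpose T ** D = conj_transpose T ** T"
  proof -
    have "conj_transpose T ** D = conj_transpose Y ** (J ** D)"
      unfolding ctT by (simp add: matrix_mul_assoc)
    also have "\<dots> = conj_transpose Y ** (J ** conj_transpose J ** Y)"
      by (simp add: eq(1) LY)
    also have "\<dots> = conj_transpose T ** T"
      by (simp add: T_def ct_mult matrix_mul_assoc)
    finally show ?thesis .
  qed
  have sym1: "conj_transpose T ** D = D ** T"
  proof -
    have "D ** T = conj_transpose (conj_transpose T ** D)"
      by (simp add: ct_mult ctD)
    also have "\<dots> = conj_transpose T ** T"
      unfolding TT by (simp add: ct_mult)
    finally show ?thesis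
      using TT by simp
  qed
  have sym2: "D ** conj_transpose T = T ** D"
  proof -
    have DT: "D ** conj_transpose T = T ** conj_transpose T"
    proof -
      have "D ** conj_transpose T = conj_transpose J ** (J ** D ** conj_transpose Y) ** J"
        unfolding ctT by (simp add: matrix_mul_assoc J KD)
      also have "\<dots> = T ** conj_transpose T"
        unfolding eq(2) by (simp add: T_def ct_mult matrix_mul_assoc)
      finally show ?thesis .
    qed
    have "T ** D = conj_transpose (D ** conj_transpose T)"
      by (simp add: ct_mult ctD)
    also have "\<dots> = T ** conj_transpose T"
      unfolding DT by (simp add: ct_mult)
    finally show ?thesis
      using DT by simp
  qed
  have e1: "cnj (T $ b $ a) * of_real (d b) = of_real (d a) * T $ a $ b" for a b
    using arg_cong[OF sym1, of "\<lambda>M. M $ a $ b"] by (simp add: D_def mult_diag_nth diag_mult_nth)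
  have e2: "of_real (d a) * cnj (T $ b $ a) = T $ a $ b * of_real (d b)" for a b
    using arg_cong[OF sym2, of "\<lambda>M. M $ a $ b"] by (simp add: D_def mult_diag_nth diag_mult_nth)
  have pos: "d a \<noteq> 0 \<and> d b \<noteq> 0" if "T $ a $ b \<noteq> 0" for a b
    using that arg_cong[OF KT, of "\<lambda>M. M $ a $ b"] arg_cong[OF TK, of "\<lambda>M. M $ a $ b"]
    by (auto simp: K_def mult_diag_nth diag_mult_nth split: if_splits)
  have deq: "d a = d b" if "T $ a $ b \<noteq> 0" for a b
  proof -
    have "of_real (d a * d a) * T $ a $ b = of_real (d a) * (cnj (T $ b $ a) * of_real (d b))"
      by (simp add: e1)
    also have "\<dots> = of_real (d b * d b) * T $ a $ b"
      using e2[of a b] by (simp add: mult_ac)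
    finally have "d a * d a = d b * d b"
      using that by (simp del: of_real_mult)
    then show ?thesis
      using d[of a] d[of b] by (metis power2_eq_square power2_eq_iff_nonneg)
  qed
  have herm: "cnj (T $ b $ a) = T $ a $ b" for a b
  proof (cases "T $ a $ b = 0")
    case True
    then show ?thesis
      using e1[of b a] pos[of b a] by auto
  next
    case False
    then show ?thesis
      using e1[of b a] pos[of a b] deq[of a b] by (auto simp: mult.commute)
  qed
  define P where "P = (\<chi> a b. T $ a $ b / of_real (d b))"
  have Pd: "d a = d b \<and> d b \<noteq> 0" if "P $ a $ b \<noteq> 0" for a b
    using that pos[of a b] deq[of a b] by (auto simp: P_def)
  have ctP: "conj_transpose P = P"
  proof -
    have "cnj (P $ b $ a) = P $ a $ b" for a b
      using herm[of b a] deq[of a b] by (cases "T $ a $ b = 0") (auto simp: P_def)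
    then show ?thesis
      by (simp add: vec_eq_iff)
  qed
  have PD: "P ** D = T"
    using pos by (auto simp: vec_eq_iff P_def D_def mult_diag_nth)
  have comm: "P ** D = D ** P"
    unfolding D_def by (rule diag_matrix_commute) (use Pd in auto)
  have PP: "P ** P = P"
  proof -
    have "P ** D ** D = P ** D ** (P ** D)"
      using TT PD ct_mult[of D P] by (simp add: comm ctP ctD)
    also have "\<dots> = P ** (D ** P) ** D"
      by (simp add: matrix_mul_assoc)
    finally have PPD: "P ** D ** D = P ** P ** D ** D"
      unfolding comm[symmetric] by (simp add: matrix_mul_assoc)
    have "(P ** P) $ a $ b = P $ a $ b" for a b
    proof (cases "d b = 0")
      case True
      then have "P $ c $ b = 0" for c
        using Pd[of c b] by auto
      then show ?thesis
        by (simp add: matrix_matrix_mult_def)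
    next
      case False
      then show ?thesis
        using arg_cong[OF PPD, of "\<lambda>M. M $ a $ b"] by (simp add: D_def mult_diag_nth)
    qed
    then show ?thesis
      by (simp add: vec_eq_iff)
  qed
  show ?thesis
    using that[OF ctP PP Pd] Y PD comm by (simp add: D_def matrix_mul_assoc)
qed

lemma diag_frame_factorization:
  fixes \<rho> :: "'m::finite \<Rightarrow> nat" and \<kappa> :: "'n::finite \<Rightarrow> nat"
  assumes \<rho>: "bij_betw \<rho> UNIV {1..CARD('m)}" and \<kappa>: "bij_betw \<kappa> UNIV {1..CARD('n)}"
    and r: "r \<le> CARD('m)" and s: "\<forall>i\<in>{1..r}. 0 < s i"
    and d_def: "\<And>b. d b = (if \<kappa> b \<le> r then s (\<kappa> b) else 0)"
  defines "J \<equiv> diag_frame \<rho> \<kappa> r :: complex^'n^'m"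
  shows "0 \<le> d b"
    and "conj_transpose J ** J = diag_matrix (\<lambda>b. if d b = 0 then 0 else 1)"
    and "J ** diag_matrix (\<lambda>b. if d b = 0 then 0 else 1) = J"
    and "J ** diag_matrix (\<lambda>b. of_real (d b)) = rect_diag \<rho> \<kappa> (\<lambda>i. if i \<le> r then s i else 0)"
proof -
  have \<kappa>1: "1 \<le> \<kappa> b" for b
    using \<kappa> by (auto simp: bij_betw_def)
  have d: "0 \<le> d b" "d b = 0 \<longleftrightarrow> \<not> \<kappa> b \<le> r" for b
    using bspec[OF s, of "\<kappa> b"] \<kappa>1[of b] by (auto simp: d_def)
  have ind: "(\<lambda>b. if d b = 0 then 0 else 1) = (\<lambda>b. if \<kappa> b \<le> r then 1 else 0 :: complex)"
    by (auto simp: d(2))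
  show "0 \<le> d b"
    by (rule d)
  show "conj_transpose J ** J = diag_matrix (\<lambda>b. if d b = 0 then 0 else 1)"
    unfolding ind J_def by (rule frame_gram[OF \<rho> \<kappa> r])
  show "J ** diag_matrix (\<lambda>b. if d b = 0 then 0 else 1) = J"
    by (auto simp: vec_eq_iff mult_diag_nth d(2) J_def diag_frame_def rect_diag_def)
  show "J ** diag_matrix (\<lambda>b. of_real (d b)) = rect_diag \<rho> \<kappa> (\<lambda>i. if i \<le> r then s i else 0)"
    by (auto simp: vec_eq_iff mult_diag_nth J_def d_def diag_frame_def rect_diag_def)
qed

lemma residual_normal_imp_projection:
  fixes A X :: "complex^'n^'m"
  assumes \<rho>: "bij_betw \<rho> UNIV {1..CARD('m)}" and \<kappa>: "bij_betw \<kappa> UNIV {1..CARD('n)}"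
    and r: "r \<le> CARD('m)" and svd: "is_svd \<rho> \<kappa> A r U s V" and X: "A - X \<in> normal_space X"
    and d: "\<And>b. d b = (if \<kappa> b \<le> r then s (\<kappa> b) else 0)"
  obtains P where "conj_transpose P = P" "P ** P = P" "\<And>a b. P $ a $ b \<noteq> 0 \<Longrightarrow> d a = d b \<and> d b \<noteq> 0"
    "X = U ** (rect_diag \<rho> \<kappa> (\<lambda>i. if i \<le> r then s i else 0) ** P) ** conj_transpose V"
proof -
  let ?\<Sigma> = "rect_diag \<rho> \<kappa> (\<lambda>i. if i \<le> r then s i else 0) :: complex^'n^'m"
  let ?J = "diag_frame \<rho> \<kappa> r :: complex^'n^'m"
  have U: "unitary_matrix U" and V: "unitary_matrix V" and A: "A = U ** ?\<Sigma> ** conj_transpose V"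
    and s: "\<forall>i\<in>{1..r}. 0 < s i"
    using svd by (simp_all add: is_svd_def)
  note J = diag_frame_factorization[OF \<rho> \<kappa> r s d]
  note Y = residual_normal_in_diagonal_frame[OF U V A X]
  show ?thesis
  proof (rule polar_factor_is_projection[OF J(1-3) Y(1,2)[folded J(4)]])
    fix P
    assume P: "conj_transpose P = P" "P ** P = P" "\<And>a b. P $ a $ b \<noteq> 0 \<Longrightarrow> d a = d b \<and> d b \<noteq> 0"
      and YP: "conj_transpose U ** X ** V = ?J ** diag_matrix (\<lambda>b. of_real (d b)) ** P"
    have "X = U ** (?\<Sigma> ** P) ** conj_transpose V"
      using Y(3) unfolding YP J(4) .
    with P show ?thesis
      by (rule that)
  qed
qed

lemma rect_diag_mult_indicator:
  assumes "inj \<kappa>" and "\<And>b. 1 \<le> \<kappa> b"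
  shows "rect_diag \<rho> \<kappa> (\<lambda>i. if i \<le> r then s i else 0) ** diag_matrix (\<lambda>b. if b \<in> E then 1 else 0)
     = (\<Sum>i\<in>\<kappa> ` E \<inter> {1..r}. single_diag \<rho> \<kappa> s i)"
  using assms by (auto simp: sum_single_diag vec_eq_iff mult_diag_nth rect_diag_def inj_image_mem_iff inj_eq)

text \<open>
\<open>Q\<close> is moved by \<open>J\<close> to the range of \<open>J\<close>, and \<open>Q'\<close> is taken to be the identity on the orthogonal
complement of that range. The block condition makes \<open>Q\<close> commute with \<open>J\<^sup>* J\<close> and with the diagonal
factor.
\<close>

lemma block_unitary_transport:
  fixes J :: "complex^'n^'m" and d :: "'n \<Rightarrow> real"
  assumes J: "conj_transpose J ** J = diag_matrix (\<lambda>b. if d b = 0 then 0 else 1)"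
    and JK: "J ** diag_matrix (\<lambda>b. if d b = 0 then 0 else 1) = J"
    and Q: "unitary_matrix Q" and block: "\<And>a b. Q $ a $ b \<noteq> 0 \<Longrightarrow> d a = d b"
  obtains Q' where "unitary_matrix Q'"
    "Q' ** (J ** diag_matrix (\<lambda>b. of_real (d b))) = (J ** diag_matrix (\<lambda>b. of_real (d b))) ** Q"
proof -
  define K :: "complex^'n^'n" where "K = diag_matrix (\<lambda>b. if d b = 0 then 0 else 1)"
  define D :: "complex^'n^'n" where "D = diag_matrix (\<lambda>b. of_real (d b))"
  define L where "L = J ** conj_transpose J"
  define G where "G = J ** Q ** conj_transpose J"
  have QK: "Q ** K = K ** Q" and QD: "Q ** D = D ** Q"
    unfolding K_def D_def by (rule diag_matrix_commute; use block in auto)+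
  have ctK: "conj_transpose K = K"
    by (auto simp: vec_eq_iff K_def diag_matrix_def)
  have KD: "K ** D = D"
    by (auto simp: vec_eq_iff K_def D_def diag_mult_nth mult_diag_nth) (auto simp: diag_matrix_def)
  have J: "conj_transpose J ** J = K" and JK: "J ** K = J"
    using assms(1,2) by (simp_all add: K_def)
  have KJ: "K ** conj_transpose J = conj_transpose J"
    using JK ctK ct_mult[of J K] by simp
  have LJ: "L ** J = J" and JL: "conj_transpose J ** L = conj_transpose J"
    unfolding L_def using J JK KJ by (simp_all add: matrix_mul_assoc) (simp flip: matrix_mul_assoc)
  have ctL: "conj_transpose L = L"
    by (simp add: L_def ct_mult)
  have LL: "L ** L = L"
    unfolding L_def by (metis L_def LJ matrix_mul_assoc)
  have GL: "G ** L = G"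
    unfolding G_def by (simp add: JL flip: matrix_mul_assoc)
  have LctG: "L ** conj_transpose G = conj_transpose G"
    using arg_cong[OF GL, of conj_transpose] by (simp add: ct_mult ctL)
  have GG: "G ** conj_transpose G = L"
  proof -
    have "G ** conj_transpose G = J ** Q ** (conj_transpose J ** J) ** conj_transpose Q ** conj_transpose J"
      by (simp add: G_def ct_mult matrix_mul_assoc)
    also have "\<dots> = J ** (Q ** K) ** conj_transpose Q ** conj_transpose J"
      by (simp add: J matrix_mul_assoc)
    also have "\<dots> = (J ** K) ** (Q ** conj_transpose Q) ** conj_transpose J"
      unfolding QK by (simp add: matrix_mul_assoc)
    also have "\<dots> = L"
      using Q by (simp add: JK L_def unitary_matrix_def)
    finally show ?thesis .
  qed
  define Q' where "Q' = G + (mat 1 - L)"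
  have "Q' ** conj_transpose Q' = mat 1"
    by (simp add: Q'_def ct_add ct_diff ctL matrix_add_ldistrib matrix_add_rdistrib matrix_diff_ldistrib
        matrix_diff_rdistrib GG GL LctG LL)
  then have unitary: "unitary_matrix Q'"
    by (simp add: unitary_matrix_def matrix_left_right_inverse)
  have "Q' ** J = J ** Q"
  proof -
    have "G ** J = J ** (Q ** K)"
      by (simp add: G_def J flip: matrix_mul_assoc)
    also have "\<dots> = J ** Q"
      unfolding QK by (simp add: JK matrix_mul_assoc)
    finally show ?thesis
      by (simp add: Q'_def matrix_add_rdistrib matrix_diff_rdistrib LJ)
  qed
  then have "Q' ** (J ** D) = J ** D ** Q"
    by (simp add: matrix_mul_assoc) (simp add: QD flip: matrix_mul_assoc)
  then show ?thesis
    using that unitary by (simp add: D_def)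
qed

section \<open>The critical points\<close>

theorem theorem5:
  fixes A :: "complex^'n^'m"
    and U :: "complex^'m^'m" and V :: "complex^'n^'n"
    and s :: "nat \<Rightarrow> real" and r k :: nat
    and \<rho> :: "'m \<Rightarrow> nat" and \<kappa> :: "'n \<Rightarrow> nat"
  assumes "bij_betw \<rho> UNIV {1..CARD('m)}"
    and "bij_betw \<kappa> UNIV {1..CARD('n)}"
    and "rank A = r"
    and "is_svd \<rho> \<kappa> A r U s V"
    and "1 \<le> k" and "k \<le> r"
  shows "A = (\<Sum>i=1..r. U ** single_diag \<rho> \<kappa> s i ** conj_transpose V) \<and>
    hermitian_critical_points A (rank_variety k) =
      {U' ** (\<Sum>i\<in>I. single_diag \<rho> \<kappa> s i) ** conj_transpose V' | U' V' I.
         is_svd \<rho> \<kappa> A r U' s V' \<and> I \<subseteq> {1..r} \<and> card I = k} \<and>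
    (inj_on s {1..r} \<longrightarrow>
      hermitian_critical_points A (rank_variety k) =
        {U ** (\<Sum>i\<in>I. single_diag \<rho> \<kappa> s i) ** conj_transpose V | I.
           I \<subseteq> {1..r} \<and> card I = k} \<and>
      finite (hermitian_critical_points A (rank_variety k)) \<and>
      card (hermitian_critical_points A (rank_variety k)) = r choose k)"
proof -
  let ?\<Sigma> = "rect_diag \<rho> \<kappa> (\<lambda>i. if i \<le> r then s i else 0) :: complex^'n^'m"
  let ?S = "\<lambda>I. \<Sum>i\<in>I. single_diag \<rho> \<kappa> s i :: complex^'n^'m"
  let ?C = "hermitian_critical_points A (rank_variety k)"
  note \<rho> = assms(1) and \<kappa> = assms(2) and rank = assms(3) and svd = assms(4)
  have \<rho>1: "1 \<le> \<rho> a" for a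
    using \<rho> by (auto simp: bij_betw_def)
  have \<kappa>1: "1 \<le> \<kappa> b" for b
    using \<kappa> by (auto simp: bij_betw_def)
  have inj_\<kappa>: "inj \<kappa>"
    using \<kappa> by (auto simp: bij_betw_def)
  have r: "r \<le> CARD('m)" "r \<le> CARD('n)"
    using rank rank_le_CARD[of A] by auto
  have C: "?C = {X. rank X = k \<and> A - X \<in> normal_space X}"
    using assms(3,6) by (intro critical_iff_residual_normal) simp
  have critical: "U' ** ?S I ** conj_transpose V' \<in> ?C"
    if "is_svd \<rho> \<kappa> A r U' s V'" "I \<subseteq> {1..r}" "card I = k" for U' V' I
    using that rank_partial_svd[OF that(1) rank that(2)] partial_svd_residual_normal[OF that(1,2)] \<rho>1
    by (simp add: C)
  have U: "unitary_matrix U" and V: "unitary_matrix V" and A: "A = U ** ?\<Sigma> ** conj_transpose V"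
    and s: "\<forall>i\<in>{1..r}. 0 < s i"
    using svd by (simp_all add: is_svd_def)
  define d where "d b = (if \<kappa> b \<le> r then s (\<kappa> b) else 0)" for b
  note J = diag_frame_factorization[OF \<rho> \<kappa> r(1) s d_def]
  have d0: "d b = 0 \<longleftrightarrow> \<not> \<kappa> b \<le> r" for b
    using bspec[OF s, of "\<kappa> b"] \<kappa>1[of b] by (auto simp: d_def)
  have projection: "\<exists>P. conj_transpose P = P \<and> P ** P = P \<and> (\<forall>a b. P $ a $ b \<noteq> 0 \<longrightarrow> d a = d b \<and> d b \<noteq> 0) \<and>
      X = U ** (?\<Sigma> ** P) ** conj_transpose V" if "X \<in> ?C" for X
    using residual_normal_imp_projection[OF \<rho> \<kappa> r(1) svd _ d_def, of X] that C by blast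

  have "A = (\<Sum>i=1..r. U ** single_diag \<rho> \<kappa> s i ** conj_transpose V)"
  proof -
    have "?\<Sigma> = ?S {1..r}"
      using \<rho>1 by (simp add: sum_single_diag rect_diag_def vec_eq_iff)
    then show ?thesis
      using A by (simp add: matrix_sum_ldistrib matrix_sum_rdistrib)
  qed
  moreover have "?C = {U' ** ?S I ** conj_transpose V' | U' V' I.
         is_svd \<rho> \<kappa> A r U' s V' \<and> I \<subseteq> {1..r} \<and> card I = k}" (is "_ = ?R")
  proof (intro subset_antisym subsetI)
    fix X assume X: "X \<in> ?C"
    then obtain P where P: "conj_transpose P = P" "P ** P = P" "\<And>a b. P $ a $ b \<noteq> 0 \<Longrightarrow> d a = d b"
        and XP: "X = U ** (?\<Sigma> ** P) ** conj_transpose V"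
      using projection by blast
    obtain Q E where Q: "unitary_matrix Q" "\<And>a b. Q $ a $ b \<noteq> 0 \<Longrightarrow> d a = d b"
        and PQ: "P = Q ** diag_matrix (\<lambda>a. if a \<in> E then 1 else 0) ** conj_transpose Q"
      using projection_diagonalizable_in_blocks[of P d] P by blast
    obtain Q' where Q': "unitary_matrix Q'" "Q' ** ?\<Sigma> = ?\<Sigma> ** Q"
      using block_unitary_transport[OF J(2,3) Q] unfolding J(4) by blast
    define I where "I = \<kappa> ` E \<inter> {1..r}"
    have "X = U ** (?\<Sigma> ** Q) ** diag_matrix (\<lambda>a. if a \<in> E then 1 else 0) ** conj_transpose Q ** conj_transpose V"
      by (simp add: XP PQ matrix_mul_assoc)
    also have "\<dots> = (U ** Q') ** (?\<Sigma> ** diag_matrix (\<lambda>a. if a \<in> E then 1 else 0)) ** conj_transpose (V ** Q)"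
      unfolding Q'(2)[symmetric] by (simp add: ct_mult matrix_mul_assoc)
    also have "\<dots> = (U ** Q') ** ?S I ** conj_transpose (V ** Q)"
      unfolding rect_diag_mult_indicator[OF inj_\<kappa> \<kappa>1] I_def ..
    finally have XI: "X = (U ** Q') ** ?S I ** conj_transpose (V ** Q)" .
    have "(U ** Q') ** ?\<Sigma> ** conj_transpose (V ** Q) = U ** (Q' ** ?\<Sigma>) ** conj_transpose Q ** conj_transpose V"
      by (simp add: ct_mult matrix_mul_assoc)
    also have "\<dots> = U ** ?\<Sigma> ** (Q ** conj_transpose Q) ** conj_transpose V"
      unfolding Q'(2) by (simp add: matrix_mul_assoc)
    also have "\<dots> = A"
      using Q(1) by (simp add: A unitary_matrix_def)
    finally have svd': "is_svd \<rho> \<kappa> A r (U ** Q') s (V ** Q)"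
      using svd Q(1) Q'(1) by (simp add: is_svd_def unitary_mult)
    have "card I = k"
      using rank_partial_svd[OF svd' rank, of I] \<rho>1 X XI by (auto simp: C I_def)
    then show "X \<in> ?R"
      using XI svd' by (auto simp: I_def)
  qed (use critical in auto)
  moreover have "?C = {U ** ?S I ** conj_transpose V | I. I \<subseteq> {1..r} \<and> card I = k} \<and>
      finite ?C \<and> card ?C = r choose k" if inj: "inj_on s {1..r}"
  proof -
    let ?f = "\<lambda>I. U ** ?S I ** conj_transpose V"
    let ?\<I> = "{I. I \<subseteq> {1..r} \<and> card I = k}"
    have img: "?C = ?f ` ?\<I>"
    proof (intro subset_antisym subsetI)
      fix X assume X: "X \<in> ?C"
      obtain P where "conj_transpose P = P" and P: "P ** P = P"
          and block: "\<forall>a b. P $ a $ b \<noteq> 0 \<longrightarrow> d a = d b \<and> d b \<noteq> 0"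
          and XP: "X = U ** (?\<Sigma> ** P) ** conj_transpose V"
        using projection[OF X] by (elim exE conjE) (rule that)
      have diagonal: "a = b" if "P $ a $ b \<noteq> 0" for a b
      proof -
        note block = block[rule_format, OF that]
        have eq: "d a = d b"
          by (rule block[THEN conjunct1])
        then have "d a \<noteq> 0" "d b \<noteq> 0"
          using block[THEN conjunct2] by simp_all
        then have le: "\<kappa> a \<le> r" "\<kappa> b \<le> r"
          unfolding d0 by simp_all
        then have "s (\<kappa> a) = s (\<kappa> b)"
          using eq by (simp add: d_def)
        then have "\<kappa> a = \<kappa> b"
          using inj le \<kappa>1[of a] \<kappa>1[of b] by (simp add: inj_on_eq_iff)
        then show ?thesis
          using inj_\<kappa> by (simp add: inj_eq)
      qed
      \<comment> \<open>A diagonal idempotent matrix has diagonal entries 0 and 1.\<close>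
      define E where "E = {a. P $ a $ a \<noteq> 0}"
      have "P $ a $ b = diag_matrix (\<lambda>a. if a \<in> E then 1 else 0) $ a $ b" for a b
      proof (cases "a = b")
        case True
        have "P $ b $ b = (\<Sum>c\<in>UNIV. P $ b $ c * P $ c $ b)"
          using arg_cong[OF P, of "\<lambda>M. M $ b $ b"] by (simp add: matrix_matrix_mult_def)
        also have "\<dots> = (\<Sum>c\<in>UNIV. if c = b then P $ b $ b * P $ b $ b else 0)"
          using diagonal by (intro sum.cong) auto
        finally show ?thesis
          using True by (auto simp: diag_matrix_def E_def)
      next
        case False
        then show ?thesis
          using diagonal by (auto simp: diag_matrix_def)
      qed
      then have PE: "P = diag_matrix (\<lambda>a. if a \<in> E then 1 else 0)"
        by (simp add: vec_eq_iff)
      have XI: "X = ?f (\<kappa> ` E \<inter> {1..r})"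
        using XP unfolding PE rect_diag_mult_indicator[OF inj_\<kappa> \<kappa>1] .
      have "rank X = k"
        using X by (simp add: C)
      then have "card (\<kappa> ` E \<inter> {1..r}) = k"
        using rank_partial_svd[OF svd rank _ \<rho>1, of "\<kappa> ` E \<inter> {1..r}"] unfolding XI[symmetric] by simp
      then show "X \<in> ?f ` ?\<I>"
        using XI by blast
    qed (use critical[OF svd] in auto)
    have inj_f: "inj_on ?f ?\<I>"
    proof (rule inj_onI)
      fix I I' assume I: "I \<in> ?\<I>" "I' \<in> ?\<I>" and "?f I = ?f I'"
      then have "conj_transpose U ** ?f I ** V = conj_transpose U ** ?f I' ** V"
        by simp
      then have eq: "?S I = ?S I'"
        using U V by (simp add: matrix_mul_assoc unitary_matrix_def)
          (simp add: unitary_matrix_def flip: matrix_mul_assoc)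
      have fin: "finite I" "finite I'"
        using I finite_subset by blast+
      have "i \<in> I \<longleftrightarrow> i \<in> I'" if i: "i \<in> {1..r}" for i
      proof -
        obtain a b where ab: "\<rho> a = i" "\<kappa> b = i"
          using i r \<rho> \<kappa> by (metis atLeastAtMost_iff bij_betw_def imageE le_trans)
        have "?S I $ a $ b = ?S I' $ a $ b"
          using eq by simp
        then show ?thesis
          using bspec[OF s i] ab by (simp add: sum_single_diag[OF fin(1)] sum_single_diag[OF fin(2)] rect_diag_def split: if_splits)
      qed
      then show "I = I'"
        using I by blast
    qed
    have "finite ?C"
      unfolding img by (intro finite_imageI) simp
    moreover have "card ?C = r choose k"
      unfolding img card_image[OF inj_f] using n_subsets[of "{1..r}" k] by simp
    moreover have "?C = {?f I | I. I \<subseteq> {1..r} \<and> card I = k}"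
      unfolding img by blast
    ultimately show ?thesis
      by (intro conjI)
  qed
  ultimately show ?thesis
    by blast
qed

end
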